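(* Let $\mathcal P$ be a finite chiral polytope, and suppose that \[ \left( \frac{|\Gamma^+(\mathcal P) \diamond \Gamma^+(\overline{\mathcal P})|}{|\Gamma^+(\mathcal P)|} \right)^2 > \left| \left(\Gamma^+(\mathcal P) \diamond \Gamma^+(\overline{\mathcal P})\right) \mathbin{\square} \left(\Gamma^+(\mathcal P^{\delta}) \diamond \Gamma^+(\overline{\mathcal P}^{\delta})\right) \right|. \] Then $\mathcal P \diamond \mathcal P^{\delta}$ is chiral.
   Context: An abstract polytope of rank $n$ (an $n$-polytope) is a ranked poset of faces with ranks from $-1$ to $n$, with a unique least face (rank $-1$) and a unique greatest face (rank $n$), in which every flag (maximal chain) has $n+2$ faces, which satisfies the diamond condition (whenever $F<G$ with ranks $j-1$ and $j+1$ there are exactly two $j$-faces strictly between them), and which is strongly flag-connected (any two flags $\Phi,\Psi$ are joined by a sequence of flags, consecutive ones adjacent, all containing $\Phi\cap\Psi$; two flags are adjacent if they differ in exactly one face). $\Phi^j$ denotes the unique flag differing from $\Phi$ only in its $j$-face, and $\Phi^{i,j}=(\Phi^i)^j$. Each polytope considered has a fixed base flag $\Phi$. $\mathcal P$ is chiral if its automorphism group $\Gamma(\mathcal P)$ has exactly two orbits on flags and adjacent flags lie in distinct orbits; then $\Gamma^+(\mathcal P):=\Gamma(\mathcal P)$ is generated by $\sigma_1,\dots,\sigma_{n-1}$, where $\sigma_i$ maps $\Phi$ to $\Phi^{i,i-1}$. One has $(\sigma_i\cdots\sigma_j)^2=1$ for $i<j$. Let $W^+=\langle \sigma_1,\dots,\sigma_{n-1}\mid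 (\sigma_i\cdots\sigma_j)^2=1 \text{ for } 1\le i<j\le n-1\rangle$. Writing $\Gamma^+(\mathcal P)=W^+/M$ means that $M$ is the kernel of the epimorphism $W^+\to\Gamma^+(\mathcal P)$ preserving the specified generators. For $w\in W^+$, $\overline w$ is obtained by replacing $\sigma_1$ by $\sigma_1^{-1}$, $\sigma_2$ by $\sigma_1^2\sigma_2$ and fixing $\sigma_j$ for $j\ge3$; $\delta(w)$ is obtained by replacing each $\sigma_i$ by $\sigma_{n-i}^{-1}$ (both are automorphisms of $W^+$). Put $\overline M=\{\overline w:w\in M\}$, $\delta(M)=\{\delta(w):w\in M\}$; one has $\delta(\overline M)=\overline{\delta(M)}$. If $\Gamma^+(\mathcal P)=W^+/M$ with $\mathcal P$ chiral, then $\overline M\ne M$; the mirror image $\overline{\mathcal P}$ (same faces, base flag $\Phi^0$) has $\Gamma^+(\overline{\mathcal P})=W^+/\overline M$, the dual $\mathcal P^\delta$ (reversed order) has $\Gamma^+(\mathcal P^\delta)=W^+/\delta(M)$, and $\Gamma^+(\overline{\mathcal P}^\delta)=W^+/\delta(\overline M)$. Mix and comix: for groups with specified generators $\Gamma=\langle x_1,\dots,x_k\mid R\rangle$, $\Gamma'=\langle x_1',\dots,x_k'\mid S\rangle$, the mix $\Gamma\diamond\Gamma'$ is the subgroup of $\Gamma\times\Gamma'$ with specified generators $(x_i,x_i')$, $i=1,\dots,k$, and the comix $\Gamma\mathbin{\square}\Gamma'$ is the group $\langle x_1,x_1',\dots,x_k,x_k'\mid R,S,x_1^{-1}x_1',\dots,x_k^{-1}x_k'\rangle$.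 $\mathcal P\diamond\mathcal Q$ is the flag-connected pre-polytope (polytope axioms with strong flag-connectedness weakened to flag-connectedness) built from $\Gamma^+(\mathcal P)\diamond\Gamma^+(\mathcal Q)$; it is handled through $\Gamma^+(\mathcal P\diamond\mathcal Q)=\Gamma^+(\mathcal P)\diamond\Gamma^+(\mathcal Q)=W^+/N$, and it is directly regular if $\overline N=N$ and chiral if $\overline N\ne N$ (it need not be polytopal). *)

theory Defs
  imports Complex_Main "HOL-Algebra.Generated_Groups" "HOL-Algebra.Coset"
begin

section \<open>Abstract polytopes with a base flag\<close>

record 'a polytope_data =
  faces :: "'a set"
  face_order :: "'a rel"
  face_rank :: "'a \<Rightarrow> int"
  poly_rank :: nat
  base_flag :: "'a set"

definition flags :: "'a polytope_data \<Rightarrow> 'a set set" where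
  "flags P = {C \<in> Chains (face_order P). \<forall>D \<in> Chains (face_order P). C \<subseteq> D \<longrightarrow> D = C}"

definition adjacent :: "'a set \<Rightarrow> 'a set \<Rightarrow> bool" where
  "adjacent A B \<longleftrightarrow> card (A - B) = 1 \<and> card (B - A) = 1"

definition diamond_condition :: "'a polytope_data \<Rightarrow> bool" where
  "diamond_condition P \<longleftrightarrow>
     (\<forall>(F, G) \<in> face_order P. face_rank P G = face_rank P F + 2 \<longrightarrow>
        card {H \<in> faces P. face_rank P H = face_rank P F + 1 \<and>
               (F, H) \<in> face_order P \<and> H \<noteq> F \<and> (H, G) \<in> face_order P \<and> H \<noteq> G} = 2)"

definition strongly_flag_connected :: "'a polytope_data \<Rightarrow> bool" where
  "strongly_flag_connected P \<longleftrightarrow>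
     (\<forall>A \<in> flags P. \<forall>B \<in> flags P.
        (A, B) \<in> {(C, D). C \<in> flags P \<and> D \<in> flags P \<and> adjacent C D \<and>
                       A \<inter> B \<subseteq> C \<and> A \<inter> B \<subseteq> D}\<^sup>*)"

definition abstract_polytope :: "'a polytope_data \<Rightarrow> bool" where
  "abstract_polytope P \<longleftrightarrow>
     partial_order_on (faces P) (face_order P) \<and>
     (\<forall>F \<in> faces P. -1 \<le> face_rank P F \<and> face_rank P F \<le> int (poly_rank P)) \<and>
     (\<forall>(F, G) \<in> face_order P. F \<noteq> G \<longrightarrow> face_rank P F < face_rank P G) \<and>
     (\<exists>!F. F \<in> faces P \<and> face_rank P F = -1 \<and> (\<forall>G \<in> faces P. (F, G) \<in> face_order P)) \<and>
     (\<exists>!F. F \<in> faces P \<and> face_rank P F = int (poly_rank P) \<and>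
           (\<forall>G \<in> faces P. (G, F) \<in> face_order P)) \<and>
     (\<forall>A \<in> flags P. card A = poly_rank P + 2) \<and>
     diamond_condition P \<and>
     strongly_flag_connected P \<and>
     base_flag P \<in> flags P"

text \<open>\<open>flag_flip P j A\<close> is the flag $A^j$.\<close>

definition flag_flip :: "'a polytope_data \<Rightarrow> int \<Rightarrow> 'a set \<Rightarrow> 'a set" where
  "flag_flip P j A =
     (THE B. B \<in> flags P \<and> B \<noteq> A \<and> {F \<in> B. face_rank P F \<noteq> j} = {F \<in> A. face_rank P F \<noteq> j})"

definition mirror_image :: "'a polytope_data \<Rightarrow> 'a polytope_data" where
  "mirror_image P = P\<lparr>base_flag := flag_flip P 0 (base_flag P)\<rparr>"

definition dual_polytope :: "'a polytope_data \<Rightarrow> 'a polytope_data" where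
  "dual_polytope P = P\<lparr>face_order := (face_order P)\<inverse>,
                       face_rank := (\<lambda>F. int (poly_rank P) - 1 - face_rank P F)\<rparr>"

section \<open>Automorphisms and chirality\<close>

definition poly_auts :: "'a polytope_data \<Rightarrow> ('a \<Rightarrow> 'a) set" where
  "poly_auts P = {f \<in> extensional (faces P). bij_betw f (faces P) (faces P) \<and>
     (\<forall>F \<in> faces P. \<forall>G \<in> faces P. (f F, f G) \<in> face_order P \<longleftrightarrow> (F, G) \<in> face_order P)}"

definition flag_orbit :: "'a polytope_data \<Rightarrow> 'a set \<Rightarrow> 'a set set" where
  "flag_orbit P A = {f ` A | f. f \<in> poly_auts P}"

definition chiral_polytope :: "'a polytope_data \<Rightarrow> bool" where
  "chiral_polytope P \<longleftrightarrow>
     abstract_polytope P \<and>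
     card (flag_orbit P ` flags P) = 2 \<and>
     (\<forall>A \<in> flags P. \<forall>B \<in> flags P. adjacent A B \<longrightarrow> flag_orbit P A \<noteq> flag_orbit P B)"

text \<open>Groups with specified generators \<open>gen G 1, \<dots>, gen G (num_gens G)\<close>.\<close>

record 'a gen_group = "'a monoid" +
  num_gens :: nat
  gen :: "nat \<Rightarrow> 'a"

definition sigma :: "'a polytope_data \<Rightarrow> nat \<Rightarrow> 'a \<Rightarrow> 'a" where
  "sigma P i = (THE f. f \<in> poly_auts P \<and>
     f ` base_flag P = flag_flip P (int i - 1) (flag_flip P (int i) (base_flag P)))"

text \<open>
  For a chiral polytope $\Gamma^+$ is the full automorphism group; it is only used for such
  polytopes. Automorphisms act on the right, that is, in a product \<open>f \<otimes> g\<close> the map \<open>f\<close> is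
  applied first. The relations $(\sigma_i \cdots \sigma_j)^2 = 1$ require this convention: with
  the opposite one they fail in general from rank 4 on.
\<close>

definition Gamma_plus :: "'a polytope_data \<Rightarrow> ('a \<Rightarrow> 'a) gen_group" where
  "Gamma_plus P =
     \<lparr>carrier = poly_auts P,
      mult = (\<lambda>f g. compose (faces P) g f),
      one = (\<lambda>F \<in> faces P. F),
      num_gens = poly_rank P - 1,
      gen = sigma P\<rparr>"

section \<open>Group presentations\<close>

text \<open>The letter \<open>(i, True)\<close> stands for the generator \<open>i\<close>, and \<open>(i, False)\<close> for its inverse.\<close>

type_synonym 'i word = "('i \<times> bool) list"

definition words_over :: "'i set \<Rightarrow> 'i word set" where
  "words_over X = lists (X \<times> UNIV)"

primrec word_eval :: "('a, 'b) monoid_scheme \<Rightarrow> ('i \<Rightarrow> 'a) \<Rightarrow> 'i word \<Rightarrow> 'a" where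
  "word_eval G x [] = \<one>\<^bsub>G\<^esub>"
| "word_eval G x (l # w) =
     (if snd l then x (fst l) else inv\<^bsub>G\<^esub> (x (fst l))) \<otimes>\<^bsub>G\<^esub> word_eval G x w"

inductive_set pres_rel :: "'i set \<Rightarrow> 'i word set \<Rightarrow> 'i word rel"
  for X :: "'i set" and R :: "'i word set" where
  pres_refl: "w \<in> words_over X \<Longrightarrow> (w, w) \<in> pres_rel X R"
| pres_sym: "(u, v) \<in> pres_rel X R \<Longrightarrow> (v, u) \<in> pres_rel X R"
| pres_trans: "(u, v) \<in> pres_rel X R \<Longrightarrow> (v, w) \<in> pres_rel X R \<Longrightarrow> (u, w) \<in> pres_rel X R"
| pres_append: "(u, u') \<in> pres_rel X R \<Longrightarrow> (v, v') \<in> pres_rel X R \<Longrightarrow>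
                  (u @ v, u' @ v') \<in> pres_rel X R"
| pres_cancel: "i \<in> X \<Longrightarrow> ([(i, b), (i, \<not> b)], []) \<in> pres_rel X R"
| pres_relator: "r \<in> R \<Longrightarrow> r \<in> words_over X \<Longrightarrow> (r, []) \<in> pres_rel X R"

text \<open>The group $\langle X \mid R \rangle$, as words modulo the congruence generated by \<open>R\<close>.\<close>

definition presented_group :: "'i set \<Rightarrow> 'i word set \<Rightarrow> 'i word set monoid" where
  "presented_group X R =
     \<lparr>carrier = words_over X // pres_rel X R,
      mult = (\<lambda>A B. \<Union>u \<in> A. \<Union>v \<in> B. pres_rel X R `` {u @ v}),
      one = pres_rel X R `` {[]}\<rparr>"

text \<open>
  For an element \<open>A\<close> of a presented group, the value obtained by replacing each generator \<open>i\<close> by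
  \<open>y i\<close> in a word representing \<open>A\<close>. It does not depend on the word whenever the \<open>y i\<close> satisfy
  the defining relators, and is then the homomorphism sending \<open>i\<close> to \<open>y i\<close>.
\<close>

definition subst_gens :: "('a, 'b) monoid_scheme \<Rightarrow> ('i \<Rightarrow> 'a) \<Rightarrow> 'i word set \<Rightarrow> 'a" where
  "subst_gens G y A = word_eval G y (SOME w. w \<in> A)"

section \<open>Mix and comix\<close>

definition mix :: "'a gen_group \<Rightarrow> 'b gen_group \<Rightarrow> ('a \<times> 'b) gen_group" (infixl \<open>\<diamond>\<close> 70) where
  "G \<diamond> H =
     \<lparr>carrier = generate (G \<times>\<times> H) ((\<lambda>i. (gen G i, gen H i)) ` {1..num_gens G}),
      mult = mult (G \<times>\<times> H),
      one = one (G \<times>\<times> H),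
      num_gens = num_gens G,
      gen = (\<lambda>i. (gen G i, gen H i))\<rparr>"

definition relators :: "'a gen_group \<Rightarrow> nat word set" where
  "relators G = {w \<in> words_over {1..num_gens G}. word_eval G (gen G) w = \<one>\<^bsub>G\<^esub>}"

text \<open>
  The comix does not depend on the presentations chosen for the two factors; each is presented
  here by all its relators. \<open>Inl i\<close> is the generator $x_i$ and \<open>Inr i\<close> is $x_i'$.
\<close>

definition comix :: "'a gen_group \<Rightarrow> 'b gen_group \<Rightarrow> (nat + nat) word set monoid"
    (infixl \<open>\<box>\<close> 70) where
  "G \<box> H =
     presented_group ({1..num_gens G} <+> {1..num_gens H})
       (map (apfst Inl) ` relators G \<union> map (apfst Inr) ` relators H \<union>
        (\<lambda>i. [(Inl i, False), (Inr i, True)]) ` {1..num_gens G})"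

section \<open>The group \<open>W\<^sup>+\<close> and chirality of mixes\<close>

definition Wplus_relators :: "nat \<Rightarrow> nat word set" where
  "Wplus_relators n =
     {concat (replicate 2 (map (\<lambda>k. (k, True)) [i..<Suc j])) | i j. 1 \<le> i \<and> i < j \<and> j \<le> n - 1}"

definition Wplus :: "nat \<Rightarrow> nat word set monoid" where
  "Wplus n = presented_group {1..n - 1} (Wplus_relators n)"

definition Wplus_gen :: "nat \<Rightarrow> nat \<Rightarrow> nat word set" where
  "Wplus_gen n i = pres_rel {1..n - 1} (Wplus_relators n) `` {[(i, True)]}"

definition Wplus_bar :: "nat \<Rightarrow> nat word set \<Rightarrow> nat word set" where
  "Wplus_bar n = subst_gens (Wplus n)
     (\<lambda>i. if i = 1 then inv\<^bsub>Wplus n\<^esub> (Wplus_gen n 1)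
          else if i = 2 then (Wplus_gen n 1 [^]\<^bsub>Wplus n\<^esub> (2::nat)) \<otimes>\<^bsub>Wplus n\<^esub> Wplus_gen n 2
          else Wplus_gen n i)"

text \<open>The subgroup \<open>M\<close> such that \<open>G\<close>, a quotient of $W^+$, is $W^+/M$.\<close>

definition Wplus_kernel :: "nat \<Rightarrow> 'a gen_group \<Rightarrow> nat word set set" where
  "Wplus_kernel n G = kernel (Wplus n) G (subst_gens G (gen G))"

text \<open>
  The pre-polytope $P \diamond Q$ enters through its group $\Gamma^+(P) \diamond \Gamma^+(Q) = W^+/N$;
  by definition it is chiral if $\overline{N} \neq N$.
\<close>

definition mix_chiral :: "'a polytope_data \<Rightarrow> 'b polytope_data \<Rightarrow> bool" where
  "mix_chiral P Q \<longleftrightarrow>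
     (let n = poly_rank P; N = Wplus_kernel n (Gamma_plus P \<diamond> Gamma_plus Q)
      in Wplus_bar n ` N \<noteq> N)"

end

theory Submission
  imports Defs
begin

text \<open>
  Write $\Gamma^+(P) = W^+/M$ and suppose that $N = M \cap \delta(M)$ is invariant under the bar
  automorphism. Then $N$ also lies in $\overline M$ and in $\delta(\overline M)$, so that $W^+/N$ is the
  mix of $W^+/A$ and $W^+/\delta(A)$, where $A = M \cap \overline M$. Since
  $|W^+/(A \cap B)| \cdot |W^+/AB| = |W^+/A| \cdot |W^+/B|$, the product of $|W^+/N|$ with the order of
  the comix is $|W^+/A|^2$; but $|W^+/N| \le |\Gamma^+(P)|^2$, which contradicts the hypothesis.

  The automorphism groups of $P$, its mirror image, its dual and the dual of its mirror image coincide
  as abstract groups, and only the distinguished generators differ. The relations between these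
  generators are read off from the action on flags: automorphisms commute with all flips and act
  freely.
\<close>

section \<open>Words and presented groups\<close>

text \<open>Lying in M, in its bar or in one of their duals is expressed as triviality of a word at
  the generators of the corresponding polytope, all read inside the automorphism group of P. So
  delta is not built as a map on W+; it is present as the passage to the dual.

  With A the mix of P and its mirror image and B its dual counterpart, as in the final proof,
  one-sided estimates suffice: |A|^2 <= |A| |B| <= |mix of A and B| |comix of A and B| <= |Gamma|^2
  |comix of A and B|.

  The obstacle is a mismatch of base flags. The bar applied on the dual side yields the mirror image
  of the dual, which in terms of P is based at the flag with the (n - 1)-face changed; the
  hypothesis speaks of the dual of the mirror image, based at the flag with the 0-face changed.
  Chirality gives an automorphism between these two flags, and conjugation by it does not affect
  which words are trivial. This is the geometric content of the commutation of delta and bar on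
  M.\<close>

definition word_inv :: "'i word \<Rightarrow> 'i word" where
  "word_inv w = rev (map (apsnd Not) w)"

lemma words_over_Nil [simp]: "[] \<in> words_over X"
  by (simp add: words_over_def)

lemma words_over_Cons [simp]: "l # w \<in> words_over X \<longleftrightarrow> fst l \<in> X \<and> w \<in> words_over X"
  by (cases l) (auto simp: words_over_def)

lemma words_over_append [simp]: "u @ v \<in> words_over X \<longleftrightarrow> u \<in> words_over X \<and> v \<in> words_over X"
  by (simp add: words_over_def)

lemma words_over_map_apfst: "w \<in> words_over X \<Longrightarrow> f ` X \<subseteq> Y \<Longrightarrow> map (apfst f) w \<in> words_over Y"
  by (induction w) auto

lemma word_inv_Nil [simp]: "word_inv [] = []"
  by (simp add: word_inv_def)

lemma word_inv_Cons [simp]: "word_inv (l # w) = word_inv w @ [(fst l, \<not> snd l)]"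
  by (cases l) (simp add: word_inv_def)

lemma words_over_word_inv [simp]: "word_inv w \<in> words_over X \<longleftrightarrow> w \<in> words_over X"
  by (induction w) auto

lemma word_eval_cong:
  "w \<in> words_over X \<Longrightarrow> (\<And>i. i \<in> X \<Longrightarrow> x i = y i) \<Longrightarrow> word_eval G x w = word_eval G y w"
  by (induction w) auto

lemma word_eval_map_apfst: "word_eval G x (map (apfst f) w) = word_eval G (x \<circ> f) w"
  by (induction w) auto

context group
begin

lemma word_eval_closed [intro]:
  "w \<in> words_over X \<Longrightarrow> x ` X \<subseteq> carrier G \<Longrightarrow> word_eval G x w \<in> carrier G"
  by (induction w) auto

lemma word_eval_append:
  assumes "u \<in> words_over X" "v \<in> words_over X" "x ` X \<subseteq> carrier G"
  shows "word_eval G x (u @ v) = word_eval G x u \<otimes> word_eval G x v"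
  using assms(1)
proof (induction u)
  case Nil
  then show ?case using word_eval_closed[OF assms(2,3)] by simp
next
  case (Cons l u)
  then have "x (fst l) \<in> carrier G" "word_eval G x u \<in> carrier G"
    using assms(3) by auto
  then show ?case
    using Cons word_eval_closed[OF assms(2,3)] by (simp add: m_assoc)
qed

lemma word_eval_word_inv:
  assumes "w \<in> words_over X" "x ` X \<subseteq> carrier G"
  shows "word_eval G x (word_inv w) = inv (word_eval G x w)"
  using assms(1)
proof (induction w)
  case (Cons l w)
  then have "x (fst l) \<in> carrier G" "word_eval G x w \<in> carrier G"
    using assms(2) by auto
  then show ?case
    using Cons assms(2) word_eval_append[of "word_inv w" X "[(fst l, \<not> snd l)]" x]
    by (simp add: inv_mult_group)
qed simp

text \<open>Turns membership in a generated subgroup into the existence of a word, so that elements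
  of a mix can be handled as pairs of values of one word.\<close>

lemma word_eval_image_eq_generate:
  assumes "x ` X \<subseteq> carrier G"
  shows "word_eval G x ` words_over X = generate G (x ` X)"
proof
  show "word_eval G x ` words_over X \<subseteq> generate G (x ` X)"
  proof clarify
    fix w assume "w \<in> words_over X"
    then show "word_eval G x w \<in> generate G (x ` X)"
      by (induction w) (auto intro: generate.intros)
  qed
  show "generate G (x ` X) \<subseteq> word_eval G x ` words_over X"
  proof
    fix g assume "g \<in> generate G (x ` X)"
    then show "g \<in> word_eval G x ` words_over X"
    proof induction
      case one
      then show ?case by (intro image_eqI[of _ _ "[]"]) auto
    next
      case (incl h)
      then obtain i where "i \<in> X" "h = x i" by auto
      then show ?case using assms by (intro image_eqI[of _ _ "[(i, True)]"]) auto
    next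
      case (inv h)
      then obtain i where "i \<in> X" "h = x i" by auto
      then show ?case using assms by (intro image_eqI[of _ _ "[(i, False)]"]) auto
    next
      case (eng g h)
      then obtain u v where "u \<in> words_over X" "v \<in> words_over X"
        "g = word_eval G x u" "h = word_eval G x v" by auto
      then show ?case
        using word_eval_append[of u X v x] assms by (intro image_eqI[of _ _ "u @ v"]) auto
    qed
  qed
qed

text \<open>Moving a base flag within its orbit conjugates all generators by one automorphism; hence
  the set of trivial words stays the same.\<close>

lemma word_eval_conjugate:
  assumes "w \<in> words_over X" "x ` X \<subseteq> carrier G" "h \<in> carrier G"
  shows "word_eval G (\<lambda>i. inv h \<otimes> x i \<otimes> h) w = inv h \<otimes> word_eval G x w \<otimes> h"
  using assms(1)
proof (induction w)
  case Nil
  then show ?case using assms(3) by simp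
next
  case (Cons l w)
  have conj: "(inv h \<otimes> a \<otimes> h) \<otimes> (inv h \<otimes> b \<otimes> h) = inv h \<otimes> (a \<otimes> b) \<otimes> h"
    if "a \<in> carrier G" "b \<in> carrier G" for a b
    using that assms(3) by (simp add: m_assoc inv_solve_left flip: m_assoc[of h])
  have x: "x (fst l) \<in> carrier G" and w: "word_eval G x w \<in> carrier G"
    using Cons assms(2) by auto
  have "inv (inv h \<otimes> x (fst l) \<otimes> h) = inv h \<otimes> inv (x (fst l)) \<otimes> h"
    using x assms(3) by (simp add: inv_mult_group m_assoc)
  then show ?case
    using Cons x w conj by simp
qed

end

lemma (in group_hom) word_eval_hom:
  assumes "w \<in> words_over X" "x ` X \<subseteq> carrier G"
  shows "h (word_eval G x w) = word_eval H (h \<circ> x) w"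
  using assms(1)
proof (induction w)
  case (Cons l w)
  then have "x (fst l) \<in> carrier G" "word_eval G x w \<in> carrier G"
    using assms(2) by auto
  then show ?case using Cons by auto
qed simp

section \<open>Presented groups as words modulo a congruence, and the homomorphisms out of
  them\<close>

lemma equiv_pres_rel: "equiv (words_over X) (pres_rel X R)"
proof (rule equivI)
  have "u \<in> words_over X \<and> v \<in> words_over X" if "(u, v) \<in> pres_rel X R" for u v
    using that by induction auto
  then show "pres_rel X R \<subseteq> words_over X \<times> words_over X" by auto
  show "refl_on (words_over X) (pres_rel X R)"
    by (auto simp: refl_on_def intro: pres_refl)
  show "sym (pres_rel X R)" by (auto intro: symI pres_sym)
  show "trans (pres_rel X R)" by (auto intro: transI pres_trans)
qed

abbreviation pres_class :: "'i set \<Rightarrow> 'i word set \<Rightarrow> 'i word \<Rightarrow> 'i word set" where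
  "pres_class X R w \<equiv> pres_rel X R `` {w}"

lemma pres_class_eq_iff:
  "u \<in> words_over X \<Longrightarrow> v \<in> words_over X \<Longrightarrow>
     pres_class X R u = pres_class X R v \<longleftrightarrow> (u, v) \<in> pres_rel X R"
  by (rule eq_equiv_class_iff[OF equiv_pres_rel])

lemma carrier_presented_group:
  "carrier (presented_group X R) = pres_class X R ` words_over X"
  by (auto simp: presented_group_def quotient_def)

lemma pres_class_closed [simp]:
  "w \<in> words_over X \<Longrightarrow> pres_class X R w \<in> carrier (presented_group X R)"
  by (auto simp: carrier_presented_group)

lemma one_presented_group: "\<one>\<^bsub>presented_group X R\<^esub> = pres_class X R []"
  by (simp add: presented_group_def)

lemma mult_presented_group:
  assumes "u \<in> words_over X" "v \<in> words_over X"
  shows "pres_class X R u \<otimes>\<^bsub>presented_group X R\<^esub> pres_class X R v = pres_class X R (u @ v)"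
proof -
  have "pres_class X R (u' @ v') = pres_class X R (u @ v)"
    if "(u, u') \<in> pres_rel X R" "(v, v') \<in> pres_rel X R" for u' v'
    using equiv_class_eq[OF equiv_pres_rel pres_append[OF that]] by simp
  then have "(\<Union>u'\<in>pres_class X R u. \<Union>v'\<in>pres_class X R v. pres_class X R (u' @ v')) =
      (\<Union>u'\<in>pres_class X R u. \<Union>v'\<in>pres_class X R v. pres_class X R (u @ v))"
    by (intro SUP_cong refl) auto
  moreover have "u \<in> pres_class X R u" "v \<in> pres_class X R v"
    using assms by (auto intro: pres_refl)
  ultimately show ?thesis by (auto simp: presented_group_def)
qed

lemma pres_word_inv_append: "w \<in> words_over X \<Longrightarrow> (word_inv w @ w, []) \<in> pres_rel X R"
proof (induction w)
  case Nil
  then show ?case by (simp add: pres_refl)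
next
  case (Cons l w)
  have l: "([(fst l, \<not> snd l)] @ [l], []) \<in> pres_rel X R"
    using Cons.prems pres_cancel[of "fst l" X "\<not> snd l" R] by simp
  have w: "(w, w) \<in> pres_rel X R" "(word_inv w, word_inv w) \<in> pres_rel X R"
    using Cons.prems by (auto intro: pres_refl)
  have "(word_inv w @ ([(fst l, \<not> snd l)] @ [l]) @ w, word_inv w @ [] @ w) \<in> pres_rel X R"
    by (intro pres_append l w)
  then show ?case using Cons by (auto intro: pres_trans)
qed

lemma group_presented_group: "group (presented_group X R)"
proof (rule groupI)
  fix A assume "A \<in> carrier (presented_group X R)"
  then obtain w where w: "w \<in> words_over X" "A = pres_class X R w"
    by (auto simp: carrier_presented_group)
  then show "\<exists>B\<in>carrier (presented_group X R).
      B \<otimes>\<^bsub>presented_group X R\<^esub> A = \<one>\<^bsub>presented_group X R\<^esub>"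
    by (intro bexI[of _ "pres_class X R (word_inv w)"])
      (simp_all add: mult_presented_group one_presented_group pres_class_eq_iff pres_word_inv_append)
qed (auto simp: carrier_presented_group one_presented_group mult_presented_group)

lemma inv_presented_group:
  assumes "w \<in> words_over X"
  shows "inv\<^bsub>presented_group X R\<^esub> (pres_class X R w) = pres_class X R (word_inv w)"
proof -
  interpret group "presented_group X R" by (rule group_presented_group)
  show ?thesis
    using assms by (intro inv_equality)
      (simp_all add: mult_presented_group one_presented_group pres_class_eq_iff pres_word_inv_append)
qed

lemma word_eval_presented_group:
  assumes "w \<in> words_over X"
  shows "word_eval (presented_group X R) (\<lambda>i. pres_class X R [(i, True)]) w = pres_class X R w"
  using assms
proof (induction w)
  case Nil
  then show ?case by (simp add: one_presented_group)
next
  case (Cons l w)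
  then show ?case
    using mult_presented_group[of "[l]" X w R] inv_presented_group[of "[(fst l, True)]" X R]
    by (cases l) auto
qed

text \<open>Von Dyck's theorem on words: equality of values is a congruence that respects
  cancellation and, by assumption, the relators, so it contains the least such congruence.\<close>

lemma (in group) word_eval_pres_rel:
  assumes "(u, v) \<in> pres_rel X R" "x ` X \<subseteq> carrier G"
    and "\<And>r. r \<in> R \<Longrightarrow> r \<in> words_over X \<Longrightarrow> word_eval G x r = \<one>"
  shows "word_eval G x u = word_eval G x v"
  using assms(1)
proof induction
  case (pres_append u u' v v')
  then have "u \<in> words_over X" "u' \<in> words_over X" "v \<in> words_over X" "v' \<in> words_over X"
    using equiv_type[OF equiv_pres_rel] by blast+
  then show ?case
    using pres_append assms(2) by (simp add: word_eval_append)
next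
  case (pres_cancel i b)
  then have "x i \<in> carrier G" using assms(2) by auto
  then show ?case by simp
qed (use assms(3) in auto)

text \<open>Removes the arbitrary choice in \<open>subst_gens\<close>: the chosen word and
  \<open>w\<close> are congruent, hence have equal values.\<close>

lemma (in group) subst_gens_pres_class:
  assumes "w \<in> words_over X" "x ` X \<subseteq> carrier G"
    and "\<And>r. r \<in> R \<Longrightarrow> r \<in> words_over X \<Longrightarrow> word_eval G x r = \<one>"
  shows "subst_gens G x (pres_class X R w) = word_eval G x w"
proof -
  have "w \<in> pres_class X R w" using assms(1) by (auto intro: pres_refl)
  then have "(SOME v. v \<in> pres_class X R w) \<in> pres_class X R w" by (rule someI)
  then show ?thesis
    unfolding subst_gens_def using word_eval_pres_rel[OF _ assms(2,3)] by auto
qed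

lemma (in group) subst_gens_hom:
  assumes "x ` X \<subseteq> carrier G"
    and "\<And>r. r \<in> R \<Longrightarrow> r \<in> words_over X \<Longrightarrow> word_eval G x r = \<one>"
  shows "group_hom (presented_group X R) G (subst_gens G x)"
proof -
  have "subst_gens G x \<in> hom (presented_group X R) G"
    using assms
    by (intro homI)
      (auto simp: carrier_presented_group mult_presented_group subst_gens_pres_class word_eval_append)
  then show ?thesis
    by (simp add: group_hom_def group_hom_axioms_def group_presented_group is_group)
qed

section \<open>Mix and comix\<close>

text \<open>Two levels are kept apart: automorphism groups enter with distinguished elements only,
  whereas a mix, being a generated subgroup by definition, satisfies the stronger
  \<open>generated_grp\<close>.\<close>

locale gen_grp = group G for G (structure) +
  assumes gen_closed: "gen G ` {1..num_gens G} \<subseteq> carrier G"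

locale generated_grp = gen_grp +
  assumes carrier_eq: "carrier G = word_eval G (gen G) ` words_over {1..num_gens G}"

lemma mix_sel [simp]:
  "num_gens (G \<diamond> H) = num_gens G" "gen (G \<diamond> H) = (\<lambda>i. (gen G i, gen H i))"
  "\<one>\<^bsub>G \<diamond> H\<^esub> = (\<one>\<^bsub>G\<^esub>, \<one>\<^bsub>H\<^esub>)"
  "(a, b) \<otimes>\<^bsub>G \<diamond> H\<^esub> (c, d) = (a \<otimes>\<^bsub>G\<^esub> c, b \<otimes>\<^bsub>H\<^esub> d)"
  by (simp_all add: mix_def)

lemma
  fixes G :: "'a gen_group" and H :: "'b gen_group"
  assumes "gen_grp G" "gen_grp H" "num_gens H = num_gens G"
  shows generated_grp_mix: "generated_grp (G \<diamond> H)"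
    and carrier_mix: "carrier (G \<diamond> H) =
      (\<lambda>w. (word_eval G (gen G) w, word_eval H (gen H) w)) ` words_over {1..num_gens G}"
    and word_eval_mix: "\<And>w. w \<in> words_over {1..num_gens G} \<Longrightarrow>
      word_eval (G \<diamond> H) (gen (G \<diamond> H)) w = (word_eval G (gen G) w, word_eval H (gen H) w)"
    and inv_mix: "\<And>a b. (a, b) \<in> carrier (G \<diamond> H) \<Longrightarrow> inv\<^bsub>G \<diamond> H\<^esub> (a, b) = (inv\<^bsub>G\<^esub> a, inv\<^bsub>H\<^esub> b)"
    and carrier_mix_subset: "carrier (G \<diamond> H) \<subseteq> carrier G \<times> carrier H"
proof -
  interpret G: gen_grp G by fact
  interpret H: gen_grp H by fact
  interpret GH: group "G \<times>\<times> H" by (rule DirProd_group) unfold_locales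
  let ?X = "{1..num_gens G}" and ?x = "\<lambda>i. (gen G i, gen H i)"
  have x: "?x ` ?X \<subseteq> carrier (G \<times>\<times> H)"
    using G.gen_closed H.gen_closed assms(3) by (auto simp: image_subset_iff)
  have eval: "word_eval (G \<times>\<times> H) ?x w = (word_eval G (gen G) w, word_eval H (gen H) w)"
    if "w \<in> words_over ?X" for w
    using that
  proof (induction w)
    case (Cons l w)
    then have "gen G (fst l) \<in> carrier G" "gen H (fst l) \<in> carrier H"
      using G.gen_closed H.gen_closed assms(3) by (auto simp: image_subset_iff)
    then show ?case
      using Cons by (simp add: inv_DirProd[OF G.is_group H.is_group])
  qed simp
  have sub: "subgroup (generate (G \<times>\<times> H) (?x ` ?X)) (G \<times>\<times> H)"
    by (rule GH.generate_is_subgroup[OF x])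
  \<comment> \<open>The mix is a record with extra fields and not literally the product with its
    carrier replaced, so the group axioms are carried over one by one from the subgroup
    \<open>C\<close>.\<close>
  define C where "C = carrier (G \<diamond> H)"
  have C: "C = generate (G \<times>\<times> H) (?x ` ?X)" by (simp add: C_def mix_def)
  interpret S: group "(G \<times>\<times> H)\<lparr>carrier := C\<rparr>"
    unfolding C by (rule subgroup.subgroup_is_group[OF sub GH.is_group])
  have mult: "mult (G \<diamond> H) = mult (G \<times>\<times> H)" and one: "one (G \<diamond> H) = one (G \<times>\<times> H)"
    by (simp_all add: mix_def)
  have grp: "group (G \<diamond> H)"
  proof (rule groupI, unfold mult one C_def[symmetric])
    fix a b c
    show "\<one>\<^bsub>G \<times>\<times> H\<^esub> \<in> C" using S.one_closed by simp
    assume a: "a \<in> C"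
    then show "\<one>\<^bsub>G \<times>\<times> H\<^esub> \<otimes>\<^bsub>G \<times>\<times> H\<^esub> a = a" using S.l_one[of a] by simp
    show "\<exists>y\<in>C. y \<otimes>\<^bsub>G \<times>\<times> H\<^esub> a = \<one>\<^bsub>G \<times>\<times> H\<^esub>" using S.l_inv_ex[of a] a by simp
    assume b: "b \<in> C"
    show "a \<otimes>\<^bsub>G \<times>\<times> H\<^esub> b \<in> C" using S.m_closed[of a b] a b by simp
    assume c: "c \<in> C"
    show "a \<otimes>\<^bsub>G \<times>\<times> H\<^esub> b \<otimes>\<^bsub>G \<times>\<times> H\<^esub> c = a \<otimes>\<^bsub>G \<times>\<times> H\<^esub> (b \<otimes>\<^bsub>G \<times>\<times> H\<^esub> c)"
      using S.m_assoc[of a b c] a b c by simp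
  qed
  show sub': "carrier (G \<diamond> H) \<subseteq> carrier G \<times> carrier H"
    using GH.generate_incl[OF x] by (simp add: mix_def)
  have carr: "carrier (G \<diamond> H) = word_eval (G \<times>\<times> H) ?x ` words_over ?X"
    unfolding C_def[symmetric] C GH.word_eval_image_eq_generate[OF x] ..
  then show "carrier (G \<diamond> H) =
      (\<lambda>w. (word_eval G (gen G) w, word_eval H (gen H) w)) ` words_over ?X"
    using eval by auto
  \<comment> \<open>Inverses are described relative to the carrier, so that they are componentwise
    has to be established again in the smaller group.\<close>
  show inv: "inv\<^bsub>G \<diamond> H\<^esub> (a, b) = (inv\<^bsub>G\<^esub> a, inv\<^bsub>H\<^esub> b)" if "(a, b) \<in> carrier (G \<diamond> H)" for a b
  proof -
    have ab: "a \<in> carrier G" "b \<in> carrier H" using sub' that by auto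
    have "(inv\<^bsub>G\<^esub> a, inv\<^bsub>H\<^esub> b) = inv\<^bsub>G \<times>\<times> H\<^esub> (a, b)"
      using ab by (simp add: inv_DirProd[OF G.is_group H.is_group])
    also have "\<dots> \<in> carrier (G \<diamond> H)"
      using subgroup.m_inv_closed[OF sub] that by (simp add: mix_def)
    finally show ?thesis
      using ab that by (intro group.inv_equality[OF grp]) auto
  qed
  have gens: "(gen G i, gen H i) \<in> carrier (G \<diamond> H)" if "i \<in> ?X" for i
    using that by (auto simp: mix_def intro!: generate.incl)
  show eval': "word_eval (G \<diamond> H) (gen (G \<diamond> H)) w = (word_eval G (gen G) w, word_eval H (gen H) w)"
    if "w \<in> words_over ?X" for w
    using that
  proof (induction w)
    case (Cons l w)
    then show ?case using inv gens by simp
  qed simp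
  show "generated_grp (G \<diamond> H)"
    using grp gens eval eval' carr
    by (auto simp: generated_grp_def generated_grp_axioms_def gen_grp_def gen_grp_axioms_def
        image_subset_iff)
qed

text \<open>When every relation between the \<open>x i\<close> also holds between the
  \<open>y i\<close>, the value at \<open>y\<close> is a function of the value at \<open>x\<close>:
  two words with equal values at \<open>x\<close> differ by a relation. A function cannot enlarge a
  finite set.\<close>

lemma word_eval_image_card_le:
  assumes "group G" "group H" "x ` X \<subseteq> carrier G" "y ` X \<subseteq> carrier H" "finite (carrier G)"
    and rel: "\<And>w. w \<in> words_over X \<Longrightarrow> word_eval G x w = \<one>\<^bsub>G\<^esub> \<Longrightarrow> word_eval H y w = \<one>\<^bsub>H\<^esub>"
  shows "finite (word_eval H y ` words_over X)"
    and "card (word_eval H y ` words_over X) \<le> card (word_eval G x ` words_over X)"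
proof -
  interpret G: group G by fact
  interpret H: group H by fact
  let ?W = "words_over X" and ?g = "word_eval G x" and ?h = "word_eval H y"
  have eq: "?h u = ?h v" if u: "u \<in> ?W" and v: "v \<in> ?W" and "?g u = ?g v" for u v
  proof -
    have gv: "?g v \<in> carrier G" and hu: "?h u \<in> carrier H" and hv: "?h v \<in> carrier H"
      using assms u v by auto
    have "?g (u @ word_inv v) = \<one>\<^bsub>G\<^esub>"
      using that assms(3) gv by (simp add: G.word_eval_append G.word_eval_word_inv)
    then have "?h (u @ word_inv v) = \<one>\<^bsub>H\<^esub>" using rel u v by simp
    then have "?h u \<otimes>\<^bsub>H\<^esub> inv\<^bsub>H\<^esub> (?h v) = \<one>\<^bsub>H\<^esub>"
      using u v assms(4) by (simp add: H.word_eval_append H.word_eval_word_inv)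
    then show ?thesis using H.inv_equality[of "?h u" "inv\<^bsub>H\<^esub> (?h v)"] hu hv by simp
  qed
  define f where "f a = ?h (SOME w. w \<in> ?W \<and> ?g w = a)" for a
  have "f (?g w) = ?h w" if "w \<in> ?W" for w
    unfolding f_def
    using someI[of "\<lambda>v. v \<in> ?W \<and> ?g v = ?g w" w] that by (intro eq) blast+
  then have img: "?h ` ?W = f ` ?g ` ?W" by (auto simp: image_image)
  have "?g ` ?W \<subseteq> carrier G" using assms by auto
  then have fin: "finite (?g ` ?W)" using assms(5) finite_subset by blast
  show "finite (?h ` ?W)" using img fin by simp
  show "card (?h ` ?W) \<le> card (?g ` ?W)" unfolding img by (rule card_image_le[OF fin])
qed

text \<open>Lagrange's theorem for the projection of the mix onto \<open>D\<close>. It is onto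
  because each element of \<open>D\<close> is the value of a word, and its kernel is a copy of the
  set counted on the right.\<close>

lemma order_mix_eq:
  assumes "generated_grp A" "generated_grp D" "num_gens D = num_gens A"
  shows "order (A \<diamond> D) = order D * card {a. (a, \<one>\<^bsub>D\<^esub>) \<in> carrier (A \<diamond> D)}"
proof -
  interpret A: generated_grp A by fact
  interpret D: generated_grp D by fact
  have mix: "gen_grp A" "gen_grp D" by unfold_locales
  note AD = mix assms(3)
  interpret M: generated_grp "A \<diamond> D" by (rule generated_grp_mix[OF AD])
  interpret h: group_hom "A \<diamond> D" D snd
    using carrier_mix_subset[OF AD] by unfold_locales (auto intro!: homI)
  have surj: "snd ` carrier (A \<diamond> D) = carrier D"
    using D.carrier_eq by (simp add: carrier_mix[OF AD] image_image assms(3))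
  have "order D = card (rcosets\<^bsub>A \<diamond> D\<^esub> kernel (A \<diamond> D) D snd)"
    using h.FactGroup_iso_set[OF surj]
    by (auto simp: iso_def order_def FactGroup_def dest!: bij_betw_same_card)
  moreover have "kernel (A \<diamond> D) D snd = (\<lambda>a. (a, \<one>\<^bsub>D\<^esub>)) ` {a. (a, \<one>\<^bsub>D\<^esub>) \<in> carrier (A \<diamond> D)}"
    by (auto simp: kernel_def)
  ultimately show ?thesis
    using M.lagrange[OF h.subgroup_kernel] by (simp add: card_image inj_on_def)
qed

text \<open>Let A = F/M and D = F/L with F free on the common generators. The subgroup is then ML/M,
  and A modulo it is F/ML, which is the comix.\<close>

lemma normal_mix_section:
  assumes "generated_grp A" "generated_grp D" "num_gens D = num_gens A"
  shows "{a. (a, \<one>\<^bsub>D\<^esub>) \<in> carrier (A \<diamond> D)} \<lhd> A"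
proof -
  interpret A: generated_grp A by fact
  interpret D: generated_grp D by fact
  have "gen_grp A" "gen_grp D" by unfold_locales
  note AD = this assms(3)
  interpret M: generated_grp "A \<diamond> D" by (rule generated_grp_mix[OF AD])
  let ?K = "{a. (a, \<one>\<^bsub>D\<^esub>) \<in> carrier (A \<diamond> D)}"
  have "subgroup ?K A"
  proof (rule A.subgroupI)
    show "?K \<subseteq> carrier A" using carrier_mix_subset[OF AD] by auto
    show "?K \<noteq> {}" using M.one_closed by auto
    show "inv\<^bsub>A\<^esub> a \<in> ?K" if "a \<in> ?K" for a
      using that M.inv_closed[of "(a, \<one>\<^bsub>D\<^esub>)"] by (simp add: inv_mix[OF AD])
    show "a \<otimes>\<^bsub>A\<^esub> b \<in> ?K" if "a \<in> ?K" "b \<in> ?K" for a b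
      using that M.m_closed[of "(a, \<one>\<^bsub>D\<^esub>)" "(b, \<one>\<^bsub>D\<^esub>)"] by simp
  qed
  moreover have "a \<otimes>\<^bsub>A\<^esub> b \<otimes>\<^bsub>A\<^esub> inv\<^bsub>A\<^esub> a \<in> ?K" if a: "a \<in> carrier A" and b: "b \<in> ?K" for a b
  proof -
    obtain w where w: "w \<in> words_over {1..num_gens A}" "a = word_eval A (gen A) w"
      using a A.carrier_eq by auto
    \<comment> \<open>Each \<open>a\<close> lifts to a pair \<open>(a, d)\<close> of the mix;
      conjugating \<open>(b, 1)\<close> by this pair leaves the second component trivial.\<close>
    define d where "d = word_eval D (gen D) w"
    have ad: "(a, d) \<in> carrier (A \<diamond> D)" using w by (auto simp: carrier_mix[OF AD] d_def)
    then have "d \<in> carrier D" using carrier_mix_subset[OF AD] by auto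
    moreover have "(a, d) \<otimes>\<^bsub>A \<diamond> D\<^esub> (b, \<one>\<^bsub>D\<^esub>) \<otimes>\<^bsub>A \<diamond> D\<^esub> inv\<^bsub>A \<diamond> D\<^esub> (a, d) \<in> carrier (A \<diamond> D)"
      using ad b by (intro M.m_closed M.inv_closed) auto
    ultimately show ?thesis using ad by (simp add: inv_mix[OF AD])
  qed
  ultimately show ?thesis by (simp add: A.normal_inv_iff)
qed

text \<open>The relators identifying the two copies of each generator fold the second alphabet onto
  the first. Thus the comix is generated by the letters \<open>Inl i\<close> and is an image of
  \<open>A\<close>; this will give its finiteness.\<close>

lemma carrier_comix_and_relators:
  assumes "num_gens D = num_gens A"
  defines "y \<equiv> \<lambda>i. pres_class ({1..num_gens A} <+> {1..num_gens D})
       (map (apfst Inl) ` relators A \<union> map (apfst Inr) ` relators D \<union>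
        (\<lambda>i. [(Inl i, False), (Inr i, True)]) ` {1..num_gens A}) [(Inl i, True)]"
  shows "y ` {1..num_gens A} \<subseteq> carrier (A \<box> D)"
    and "carrier (A \<box> D) = word_eval (A \<box> D) y ` words_over {1..num_gens A}"
    and "\<And>w. w \<in> relators A \<Longrightarrow> word_eval (A \<box> D) y w = \<one>\<^bsub>A \<box> D\<^esub>"
proof -
  let ?X = "{1..num_gens A}"
  define Y where "Y = ?X <+> {1..num_gens D}"
  define R where "R = map (apfst Inl) ` relators A \<union> map (apfst Inr) ` relators D \<union>
        (\<lambda>i. [(Inl i, False), (Inr i, True)]) ` ?X"
  have C: "A \<box> D = presented_group Y R" by (simp add: comix_def Y_def R_def)
  interpret C: group "A \<box> D" unfolding C by (rule group_presented_group)
  define g where "g j = pres_class Y R [(j, True)]" for j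
  have y: "y = g \<circ> Inl" by (simp add: y_def g_def Y_def R_def fun_eq_iff)
  have g: "g ` Y \<subseteq> carrier (A \<box> D)" unfolding C g_def by auto
  then show y_closed: "y ` ?X \<subseteq> carrier (A \<box> D)" unfolding y Y_def by auto
  have eval: "word_eval (A \<box> D) g w = pres_class Y R w" if "w \<in> words_over Y" for w
    using word_eval_presented_group[OF that, of R] by (simp add: C g_def[abs_def])
  have "g (Inr i) = g (Inl i)" if i: "i \<in> ?X" for i
  proof -
    have Y: "Inl i \<in> Y" "Inr i \<in> Y" using i assms(1) by (auto simp: Y_def)
    have "([(Inl i, False), (Inr i, True)], []) \<in> pres_rel Y R"
      using Y i by (intro pres_relator) (auto simp: R_def)
    then have "pres_class Y R [(Inl i, False), (Inr i, True)] = \<one>\<^bsub>A \<box> D\<^esub>"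
      using Y by (simp add: C one_presented_group pres_class_eq_iff)
    then have "word_eval (A \<box> D) g [(Inl i, False), (Inr i, True)] = \<one>\<^bsub>A \<box> D\<^esub>"
      using eval Y by (simp del: word_eval.simps)
    moreover have "g (Inl i) \<in> carrier (A \<box> D)" "g (Inr i) \<in> carrier (A \<box> D)" using g Y by auto
    ultimately show ?thesis
      by (simp add: C.inv_solve_left')
  qed
  then have fold: "g j = y (case_sum id id j)" if "j \<in> Y" for j
    using that assms(1) by (auto simp: y Y_def)
  have fold_eval: "word_eval (A \<box> D) g w = word_eval (A \<box> D) y (map (apfst (case_sum id id)) w)"
    if "w \<in> words_over Y" for w
    using word_eval_cong[OF that fold, of "\<lambda>j. j" "A \<box> D"]
    by (simp add: word_eval_map_apfst comp_def)
  have "carrier (A \<box> D) \<subseteq> word_eval (A \<box> D) y ` words_over ?X"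
  proof
    fix c assume "c \<in> carrier (A \<box> D)"
    then obtain w where w: "w \<in> words_over Y" "c = pres_class Y R w"
      by (auto simp: C carrier_presented_group)
    have "map (apfst (case_sum id id)) w \<in> words_over ?X"
      using w(1) by (rule words_over_map_apfst) (auto simp: Y_def assms(1))
    then show "c \<in> word_eval (A \<box> D) y ` words_over ?X"
      using w eval fold_eval by auto
  qed
  then show "carrier (A \<box> D) = word_eval (A \<box> D) y ` words_over ?X"
    using y_closed by auto
  show "word_eval (A \<box> D) y w = \<one>\<^bsub>A \<box> D\<^esub>" if w: "w \<in> relators A" for w
  proof -
    have "w \<in> words_over ?X" using w by (simp add: relators_def)
    then have Y: "map (apfst Inl) w \<in> words_over Y"
      by (rule words_over_map_apfst) (auto simp: Y_def)
    have "(map (apfst Inl) w, []) \<in> pres_rel Y R"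
      using Y w by (intro pres_relator) (auto simp: R_def)
    then have "word_eval (A \<box> D) g (map (apfst Inl) w) = \<one>\<^bsub>A \<box> D\<^esub>"
      using eval Y by (simp add: C one_presented_group pres_class_eq_iff)
    then show ?thesis by (simp add: word_eval_map_apfst y)
  qed
qed

text \<open>With \<open>K\<close> the section of the mix over the identity of \<open>D\<close>, the
  product of orders on the left equals \<open>order (A \<diamond> D)\<close> times the index of
  \<open>K\<close> in \<open>A\<close>. It remains to map the comix onto
  \<open>A Mod K\<close>.\<close>

lemma order_mult_le_mix_comix:
  assumes "generated_grp A" "generated_grp D" "num_gens D = num_gens A" "finite (carrier A)"
  shows "order A * order D \<le> order (A \<diamond> D) * order (A \<box> D)"
proof -
  interpret A: generated_grp A by fact
  interpret D: generated_grp D by fact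
  have "gen_grp A" "gen_grp D" by unfold_locales
  note AD = this assms(3)
  let ?X = "{1..num_gens A}"
  define K where "K = {a. (a, \<one>\<^bsub>D\<^esub>) \<in> carrier (A \<diamond> D)}"
  interpret K: normal K A unfolding K_def using assms by (intro normal_mix_section)
  interpret Q: group "A Mod K" by (rule K.factorgroup_is_group)
  interpret q: group_hom A "A Mod K" "\<lambda>a. K #>\<^bsub>A\<^esub> a"
    using K.r_coset_hom_Mod by unfold_locales
  let ?C = "A \<box> D"
  have grpC: "group ?C" unfolding comix_def by (rule group_presented_group)
  obtain y where y: "y ` ?X \<subseteq> carrier ?C" "carrier ?C = word_eval ?C y ` words_over ?X"
    and rel: "\<And>w. w \<in> relators A \<Longrightarrow> word_eval ?C y w = \<one>\<^bsub>?C\<^esub>"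
    using carrier_comix_and_relators[OF assms(3)] by blast
  \<comment> \<open>\<open>order\<close> is 0 on an infinite carrier, so finiteness of the comix is
    secured before orders are compared.\<close>
  have finC: "finite (carrier ?C)"
    unfolding y(2)
    by (rule word_eval_image_card_le(1)[OF A.is_group grpC A.gen_closed y(1) assms(4)])
      (auto intro!: rel simp: relators_def)
  define Y where "Y = ?X <+> {1..num_gens D}"
  define R where "R = map (apfst Inl) ` relators A \<union> map (apfst Inr) ` relators D \<union>
        (\<lambda>i. [(Inl i, False), (Inr i, True)]) ` ?X"
  have C: "?C = presented_group Y R" by (simp add: comix_def Y_def R_def)
  \<comment> \<open>Both copies of a generator go to the same coset, which makes the identifying
    relators trivial at once.\<close>
  define z :: "nat + nat \<Rightarrow> _" where "z = case_sum (\<lambda>i. K #>\<^bsub>A\<^esub> gen A i) (\<lambda>i. K #>\<^bsub>A\<^esub> gen A i)"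
  have gen: "gen A i \<in> carrier A" if "i \<in> ?X" for i using A.gen_closed that by auto
  have z: "z ` Y \<subseteq> carrier (A Mod K)"
    using gen assms(3) by (auto simp: z_def Y_def)
  have evalq: "word_eval (A Mod K) (\<lambda>i. K #>\<^bsub>A\<^esub> gen A i) w = K #>\<^bsub>A\<^esub> word_eval A (gen A) w"
    if "w \<in> words_over ?X" for w
    using q.word_eval_hom[OF that A.gen_closed] by (simp add: comp_def)
  have zInl: "word_eval (A Mod K) z (map (apfst Inl) w) = K #>\<^bsub>A\<^esub> word_eval A (gen A) w"
    and zInr: "word_eval (A Mod K) z (map (apfst Inr) w) = K #>\<^bsub>A\<^esub> word_eval A (gen A) w"
    if "w \<in> words_over ?X" for w
    using evalq[OF that] by (simp_all add: word_eval_map_apfst z_def comp_def)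
  have "word_eval (A Mod K) z r = \<one>\<^bsub>A Mod K\<^esub>" if "r \<in> R" for r
    using that unfolding R_def
  proof (elim UnE imageE)
    fix w assume "w \<in> relators A" "r = map (apfst Inl) w"
    then show ?thesis using zInl[of w] by (simp add: relators_def)
  next
    fix w assume w: "w \<in> relators D" "r = map (apfst Inr) w"
    then have X: "w \<in> words_over ?X" by (simp add: relators_def assms(3))
    \<comment> \<open>A word trivial in \<open>D\<close> has a value of the form
      \<open>(a, 1)\<close> in the mix, and this is membership of \<open>a\<close> in
      \<open>K\<close>. So the relators of \<open>D\<close> die modulo \<open>K\<close>.\<close>
    have "word_eval A (gen A) w \<in> K"
      using w X carrier_mix[OF AD] by (force simp: K_def relators_def)
    then have "K #>\<^bsub>A\<^esub> word_eval A (gen A) w = K"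
      by (simp add: A.coset_join2 K.subgroup_axioms)
    then show ?thesis using zInr[OF X] w by simp
  next
    fix i assume i: "i \<in> ?X" "r = [(Inl i, False), (Inr i, True)]"
    then have "K #>\<^bsub>A\<^esub> gen A i \<in> carrier (A Mod K)" using gen q.hom_closed by blast
    then show ?thesis using i by (simp add: z_def del: one_FactGroup mult_FactGroup)
  qed
  then interpret f: group_hom ?C "A Mod K" "subst_gens (A Mod K) z"
    unfolding C using z by (intro Q.subst_gens_hom) auto
  have "carrier (A Mod K) \<subseteq> subst_gens (A Mod K) z ` carrier ?C"
  proof
    fix c assume "c \<in> carrier (A Mod K)"
    then obtain a where a: "a \<in> carrier A" "c = K #>\<^bsub>A\<^esub> a"
      by (auto simp: FactGroup_def RCOSETS_def)
    then obtain w where w: "w \<in> words_over ?X" "a = word_eval A (gen A) w"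
      using A.carrier_eq by auto
    have Y: "map (apfst Inl) w \<in> words_over Y"
      using w(1) by (rule words_over_map_apfst) (auto simp: Y_def)
    have "subst_gens (A Mod K) z (pres_class Y R (map (apfst Inl) w)) = c"
      using Q.subst_gens_pres_class[OF Y z] \<open>\<And>r. r \<in> R \<Longrightarrow> _\<close> zInl[OF w(1)] a w by simp
    then show "c \<in> subst_gens (A Mod K) z ` carrier ?C"
      using Y by (force simp: C)
  qed
  then have "card (carrier (A Mod K)) \<le> order ?C"
    using surj_card_le[OF finC] by (simp add: order_def)
  then have le: "card (rcosets\<^bsub>A\<^esub> K) \<le> order ?C" by (simp add: FactGroup_def)
  have "order A * order D = order (A \<diamond> D) * card (rcosets\<^bsub>A\<^esub> K)"
    using order_mix_eq[OF assms(1-3)] A.lagrange[OF K.subgroup_axioms]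
    by (simp add: K_def[symmetric] flip: A.lagrange[OF K.subgroup_axioms])
  also have "\<dots> \<le> order (A \<diamond> D) * order ?C" using le by simp
  finally show ?thesis .
qed

section \<open>Flags of abstract polytopes\<close>

text \<open>A flag seen as a function on ranks, so that flags can be compared rank by rank.
  Meaningful for a flag and a rank between -1 and the rank of the polytope.\<close>

definition face_at :: "'a polytope_data \<Rightarrow> 'a set \<Rightarrow> int \<Rightarrow> 'a" where
  "face_at P A j = (THE F. F \<in> A \<and> face_rank P F = j)"

locale polytope =
  fixes P :: "'a polytope_data"
  assumes abstract_polytope: "abstract_polytope P"
begin

abbreviation "n \<equiv> int (poly_rank P)"

lemma partial_order: "partial_order_on (faces P) (face_order P)"
  using abstract_polytope by (simp add: abstract_polytope_def)

lemma face_order_subset: "face_order P \<subseteq> faces P \<times> faces P"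
  using partial_order by (simp add: partial_order_on_def preorder_on_def)

lemma face_order_refl: "F \<in> faces P \<Longrightarrow> (F, F) \<in> face_order P"
  using partial_order by (simp add: partial_order_on_def preorder_on_def refl_on_def)

lemma face_order_trans:
  "(F, G) \<in> face_order P \<Longrightarrow> (G, H) \<in> face_order P \<Longrightarrow> (F, H) \<in> face_order P"
  using partial_order by (auto simp: partial_order_on_def preorder_on_def dest: transD)

lemma face_rank_less: "(F, G) \<in> face_order P \<Longrightarrow> F \<noteq> G \<Longrightarrow> face_rank P F < face_rank P G"
  using abstract_polytope by (auto simp: abstract_polytope_def)

lemma face_rank_range: "F \<in> faces P \<Longrightarrow> face_rank P F \<in> {-1..n}"
  using abstract_polytope by (simp add: abstract_polytope_def)

lemma chain_subset_faces: "C \<in> Chains (face_order P) \<Longrightarrow> C \<subseteq> faces P"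
  using face_order_subset by (auto simp: Chains_def)

lemma chain_rank_inj: "C \<in> Chains (face_order P) \<Longrightarrow> inj_on (face_rank P) C"
  unfolding Chains_def
  by (intro inj_onI) (metis (mono_tags, lifting) face_rank_less less_irrefl mem_Collect_eq)

lemma chain_rank_range: "C \<in> Chains (face_order P) \<Longrightarrow> face_rank P ` C \<subseteq> {-1..n}"
  using chain_subset_faces face_rank_range by blast

lemma
  assumes "C \<in> Chains (face_order P)"
  shows chain_finite: "finite C" and chain_card_le: "card C \<le> poly_rank P + 2"
proof -
  have inj: "inj_on (face_rank P) C" and sub: "face_rank P ` C \<subseteq> {-1..n}"
    using assms by (simp_all add: chain_rank_inj chain_rank_range)
  show "finite C" using inj_on_finite[OF inj sub] by simp
  show "card C \<le> poly_rank P + 2" using card_inj_on_le[OF inj sub] by simp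
qed

text \<open>Ranks are injective on a chain and take only n + 2 values, so a chain of n + 2 faces
  admits no extension.\<close>

lemma flag_iff: "A \<in> flags P \<longleftrightarrow> A \<in> Chains (face_order P) \<and> card A = poly_rank P + 2"
proof
  assume "A \<in> flags P"
  then show "A \<in> Chains (face_order P) \<and> card A = poly_rank P + 2"
    using abstract_polytope by (simp add: abstract_polytope_def flags_def)
next
  assume A: "A \<in> Chains (face_order P) \<and> card A = poly_rank P + 2"
  have "D = A" if "D \<in> Chains (face_order P)" "A \<subseteq> D" for D
    using card_seteq[OF chain_finite[OF that(1)] that(2)] chain_card_le[OF that(1)] A by simp
  then show "A \<in> flags P" using A by (simp add: flags_def)
qed

lemma flag_chain: "A \<in> flags P \<Longrightarrow> A \<in> Chains (face_order P)"
  by (simp add: flag_iff)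

lemma flag_subset_faces: "A \<in> flags P \<Longrightarrow> A \<subseteq> faces P"
  by (simp add: flag_chain chain_subset_faces)

lemma flag_ranks:
  assumes "A \<in> flags P"
  shows "face_rank P ` A = {-1..n}"
proof (rule card_seteq)
  show "card {-1..n} \<le> card (face_rank P ` A)"
    using assms by (simp add: card_image[OF chain_rank_inj] flag_iff)
qed (use assms in \<open>auto simp: flag_iff dest!: chain_rank_range\<close>)

lemma face_at_eq: "A \<in> flags P \<Longrightarrow> F \<in> A \<Longrightarrow> face_rank P F = j \<Longrightarrow> face_at P A j = F"
  unfolding face_at_def using chain_rank_inj[OF flag_chain] by (auto dest: inj_onD)

lemma
  assumes "A \<in> flags P" "j \<in> {-1..n}"
  shows face_at_in: "face_at P A j \<in> A" and face_at_rank: "face_rank P (face_at P A j) = j"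
proof -
  have "j \<in> face_rank P ` A" using flag_ranks[OF assms(1)] assms(2) by simp
  then obtain F where "F \<in> A" "face_rank P F = j" by blast
  then show "face_at P A j \<in> A" "face_rank P (face_at P A j) = j"
    using face_at_eq[OF assms(1)] by auto
qed

lemma flag_eq_face_at:
  assumes "A \<in> flags P"
  shows "A = face_at P A ` {-1..n}"
proof -
  have "face_at P A ` face_rank P ` A = (\<lambda>F. F) ` A"
    unfolding image_image using face_at_eq[OF assms] by (intro image_cong) auto
  then show ?thesis using flag_ranks[OF assms] by simp
qed

lemma flag_le:
  assumes "A \<in> flags P" "F \<in> A" "G \<in> A" "face_rank P F \<le> face_rank P G"
  shows "(F, G) \<in> face_order P"
proof (cases "F = G")
  case True
  then show ?thesis using assms flag_subset_faces face_order_refl by blast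
next
  case False
  have "(F, G) \<in> face_order P \<or> (G, F) \<in> face_order P"
    using assms flag_chain by (auto simp: Chains_def)
  then show ?thesis using face_rank_less[of G F] False assms(4) by auto
qed

lemma face_at_le:
  "A \<in> flags P \<Longrightarrow> i \<in> {-1..n} \<Longrightarrow> j \<in> {-1..n} \<Longrightarrow> i \<le> j \<Longrightarrow>
     (face_at P A i, face_at P A j) \<in> face_order P"
  by (rule flag_le[of A]) (simp_all add: face_at_in face_at_rank del: atLeastAtMost_iff)

text \<open>Chain lengths are bounded, so among the chains through \<open>F\<close> one has largest
  size; any extension of it still contains \<open>F\<close>, which makes it maximal among all
  chains.\<close>

lemma face_in_flag:
  assumes "F \<in> faces P"
  obtains A where "A \<in> flags P" "F \<in> A"
proof -
  let ?Q = "\<lambda>C. C \<in> Chains (face_order P) \<and> F \<in> C"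
  have "?Q {F}" using assms by (simp add: Chains_def face_order_refl)
  moreover have "\<forall>C. ?Q C \<longrightarrow> card C < poly_rank P + 3"
    using chain_card_le by fastforce
  ultimately obtain C where C: "?Q C" "\<And>D. ?Q D \<Longrightarrow> card D \<le> card C"
    using ex_has_greatest_nat[of ?Q "{F}" card] by blast
  have "D = C" if "D \<in> Chains (face_order P)" "C \<subseteq> D" for D
    using card_seteq[OF chain_finite[OF that(1)] that(2)] C that by blast
  then have "C \<in> flags P" using C by (simp add: flags_def)
  then show ?thesis using C that by blast
qed

subsection \<open>Adjacent flags\<close>

text \<open>Weak comparisons are enough: when \<open>F\<close> and \<open>G\<close> have ranks j - 1
  and j + 1, the rank of \<open>H\<close> already separates it from both, and this is the set in the
  diamond condition.\<close>

definition between :: "int \<Rightarrow> 'a \<Rightarrow> 'a \<Rightarrow> 'a set" where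
  "between j F G = {H \<in> faces P. face_rank P H = j \<and> (F, H) \<in> face_order P \<and> (H, G) \<in> face_order P}"

lemma card_between:
  assumes "A \<in> flags P" "0 \<le> j" "j < n"
  shows "card (between j (face_at P A (j - 1)) (face_at P A (j + 1))) = 2"
proof -
  let ?F = "face_at P A (j - 1)" and ?G = "face_at P A (j + 1)"
  have r: "face_rank P ?F = j - 1" "face_rank P ?G = j + 1" "(?F, ?G) \<in> face_order P"
    using assms by (auto intro!: face_at_rank face_at_le)
  have "between j ?F ?G = {H \<in> faces P. face_rank P H = face_rank P ?F + 1 \<and>
               (?F, H) \<in> face_order P \<and> H \<noteq> ?F \<and> (H, ?G) \<in> face_order P \<and> H \<noteq> ?G}"
    unfolding between_def using r by auto
  moreover have "diamond_condition P" using abstract_polytope by (simp add: abstract_polytope_def)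
  ultimately show ?thesis
    using r unfolding diamond_condition_def by fastforce
qed

lemma face_at_between:
  assumes "A \<in> flags P" "0 \<le> j" "j < n"
  shows "face_at P A j \<in> between j (face_at P A (j - 1)) (face_at P A (j + 1))"
  using assms face_at_in[of A j] flag_subset_faces
  by (auto simp: between_def face_at_rank intro!: face_at_le)

lemma between_unique:
  assumes "A \<in> flags P" "0 \<le> j" "j < n"
    and "G \<in> between j (face_at P A (j - 1)) (face_at P A (j + 1))" "G \<noteq> face_at P A j"
    and "H \<in> between j (face_at P A (j - 1)) (face_at P A (j + 1))" "H \<noteq> face_at P A j"
  shows "G = H"
proof -
  have "card (between j (face_at P A (j - 1)) (face_at P A (j + 1))) = 2"
    using card_between[OF assms(1-3)] .
  then obtain x y where "between j (face_at P A (j - 1)) (face_at P A (j + 1)) = {x, y}"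
    by (auto simp: card_2_iff)
  then show ?thesis using assms face_at_between[OF assms(1-3)] by auto
qed

lemma same_faces_except_iff:
  assumes "A \<in> flags P" "B \<in> flags P"
  shows "{F \<in> B. face_rank P F \<noteq> j} = {F \<in> A. face_rank P F \<noteq> j} \<longleftrightarrow>
    (\<forall>k \<in> {-1..n} - {j}. face_at P B k = face_at P A k)"
proof
  assume L: "{F \<in> B. face_rank P F \<noteq> j} = {F \<in> A. face_rank P F \<noteq> j}"
  show "\<forall>k \<in> {-1..n} - {j}. face_at P B k = face_at P A k"
  proof
    fix k assume k: "k \<in> {-1..n} - {j}"
    then have "face_at P A k \<in> {F \<in> B. face_rank P F \<noteq> j}"
      unfolding L using assms by (simp add: face_at_in face_at_rank)
    then show "face_at P B k = face_at P A k"
      using k assms by (intro face_at_eq) (auto simp: face_at_rank)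
  qed
next
  have "F \<in> D" if "C \<in> flags P" "D \<in> flags P" "F \<in> C" "face_rank P F \<noteq> j"
    "\<forall>k \<in> {-1..n} - {j}. face_at P C k = face_at P D k" for C D F
  proof -
    have "face_rank P F \<in> {-1..n}" using that flag_ranks[OF that(1)] by blast
    then show ?thesis using that face_at_eq[of C F] face_at_in[of D "face_rank P F"] by auto
  qed
  from this[of A B] this[of B A] assms
  show "\<forall>k \<in> {-1..n} - {j}. face_at P B k = face_at P A k \<Longrightarrow>
      {F \<in> B. face_rank P F \<noteq> j} = {F \<in> A. face_rank P F \<noteq> j}"
    by auto
qed

lemma differing_face:
  assumes "A \<in> flags P" "B \<in> flags P" "B \<noteq> A" "0 \<le> j" "j < n"
    and "\<forall>k \<in> {-1..n} - {j}. face_at P B k = face_at P A k"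
  shows "face_at P B j \<in> between j (face_at P A (j - 1)) (face_at P A (j + 1))"
    and "face_at P B j \<noteq> face_at P A j"
proof -
  show "face_at P B j \<in> between j (face_at P A (j - 1)) (face_at P A (j + 1))"
    using face_at_between[OF assms(2,4,5)] assms by auto
  show "face_at P B j \<noteq> face_at P A j"
  proof
    assume "face_at P B j = face_at P A j"
    then have "\<forall>k \<in> {-1..n}. face_at P B k = face_at P A k" using assms(6) by blast
    then have "face_at P B ` {-1..n} = face_at P A ` {-1..n}" by (intro image_cong) auto
    then show False using flag_eq_face_at assms(1-3) by metis
  qed
qed

lemma flip_unique:
  assumes "A \<in> flags P" "0 \<le> j" "j < n"
    and "B \<in> flags P" "B \<noteq> A" "\<forall>k \<in> {-1..n} - {j}. face_at P B k = face_at P A k"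
    and "C \<in> flags P" "C \<noteq> A" "\<forall>k \<in> {-1..n} - {j}. face_at P C k = face_at P A k"
  shows "B = C"
proof -
  have "face_at P B j = face_at P C j"
    using assms by (intro between_unique[OF assms(1-3)] differing_face) auto
  then have "\<forall>k \<in> {-1..n}. face_at P B k = face_at P C k"
    using assms(6,9) by (metis DiffI singletonD)
  then have "face_at P B ` {-1..n} = face_at P C ` {-1..n}" by (intro image_cong) auto
  then show ?thesis using flag_eq_face_at assms(4,7) by metis
qed

text \<open>The diamond condition supplies a second face \<open>H\<close> between the neighbours of
  the j-face. Exchanging the two keeps a chain, because every other face of the flag compares with
  \<open>H\<close> through the face of rank j - 1 or j + 1.\<close>

lemma flip_exists:
  assumes A: "A \<in> flags P" and j: "0 \<le> j" "j < n"
  obtains B where "B \<in> flags P" "B \<noteq> A" "\<forall>k \<in> {-1..n} - {j}. face_at P B k = face_at P A k"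
proof -
  let ?S = "between j (face_at P A (j - 1)) (face_at P A (j + 1))"
  have "\<exists>H \<in> ?S. H \<noteq> face_at P A j"
    using card_between[OF assms] by (metis card_2_iff')
  then obtain H where H: "H \<in> ?S" "H \<noteq> face_at P A j" by blast
  define B where "B = insert H (A - {face_at P A j})"
  have H': "H \<in> faces P" "face_rank P H = j" "(face_at P A (j - 1), H) \<in> face_order P"
    "(H, face_at P A (j + 1)) \<in> face_order P" using H(1) by (auto simp: between_def)
  have comp: "(F, H) \<in> face_order P \<or> (H, F) \<in> face_order P" if F: "F \<in> A" "F \<noteq> face_at P A j" for F
  proof -
    have r: "face_rank P F \<in> {-1..n}" using F flag_ranks[OF A] by blast
    have "face_rank P F \<noteq> j" using F face_at_eq[OF A, of F j] by auto
    then consider "face_rank P F \<le> j - 1" | "j + 1 \<le> face_rank P F" by linarith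
    then show ?thesis
    proof cases
      case 1
      then have "(F, face_at P A (j - 1)) \<in> face_order P"
        using A F j by (intro flag_le[OF A]) (auto simp: face_at_in face_at_rank)
      then show ?thesis using H' face_order_trans by blast
    next
      case 2
      then have "(face_at P A (j + 1), F) \<in> face_order P"
        using A F j by (intro flag_le[OF A]) (auto simp: face_at_in face_at_rank)
      then show ?thesis using H' face_order_trans by blast
    qed
  qed
  have HA: "H \<notin> A" using H' H(2) face_at_eq[OF A, of H j] by auto
  have fA: "face_at P A j \<in> A" using A j by (intro face_at_in) auto
  have "B \<in> Chains (face_order P)"
    using comp flag_chain[OF A] face_order_refl[OF H'(1)] by (auto simp: B_def Chains_def)
  moreover have "card B = poly_rank P + 2"
  proof -
    have "finite A" "card A = poly_rank P + 2" using A chain_finite by (auto simp: flag_iff)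
    then show ?thesis using HA fA by (simp add: B_def)
  qed
  ultimately have B: "B \<in> flags P" by (simp add: flag_iff)
  moreover have "B \<noteq> A" using HA by (auto simp: B_def)
  moreover have "\<forall>k \<in> {-1..n} - {j}. face_at P B k = face_at P A k"
  proof
    fix k assume k: "k \<in> {-1..n} - {j}"
    then have "face_rank P (face_at P A k) = k" "face_at P A k \<in> A"
      using A by (auto simp: face_at_in face_at_rank)
    moreover have "face_rank P (face_at P A j) = j" using A j by (intro face_at_rank) auto
    ultimately show "face_at P B k = face_at P A k"
      using k B by (intro face_at_eq) (auto simp: B_def)
  qed
  ultimately show ?thesis using that by blast
qed

lemma flag_flip_eqI:
  assumes "A \<in> flags P" "0 \<le> j" "j < n"
    and "B \<in> flags P" "B \<noteq> A" "\<forall>k \<in> {-1..n} - {j}. face_at P B k = face_at P A k"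
  shows "flag_flip P j A = B"
  unfolding flag_flip_def
proof (rule the_equality)
  show "B \<in> flags P \<and> B \<noteq> A \<and> {F \<in> B. face_rank P F \<noteq> j} = {F \<in> A. face_rank P F \<noteq> j}"
    using assms by (simp add: same_faces_except_iff)
  fix C assume "C \<in> flags P \<and> C \<noteq> A \<and> {F \<in> C. face_rank P F \<noteq> j} = {F \<in> A. face_rank P F \<noteq> j}"
  then have "C \<in> flags P" "C \<noteq> A" "\<forall>k \<in> {-1..n} - {j}. face_at P C k = face_at P A k"
    using assms(1) same_faces_except_iff by auto
  then show "C = B" using flip_unique[OF assms(1-3)] assms(4-6) by blast
qed

lemma
  assumes "A \<in> flags P" "0 \<le> j" "j < n"
  shows flag_flip_in [simp]: "flag_flip P j A \<in> flags P"
    and flag_flip_neq: "flag_flip P j A \<noteq> A"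
    and face_at_flip: "k \<in> {-1..n} \<Longrightarrow> k \<noteq> j \<Longrightarrow> face_at P (flag_flip P j A) k = face_at P A k"
proof -
  obtain B where B: "B \<in> flags P" "B \<noteq> A" "\<forall>k \<in> {-1..n} - {j}. face_at P B k = face_at P A k"
    using flip_exists[OF assms] by blast
  then have "flag_flip P j A = B" using flag_flip_eqI[OF assms] by blast
  then show "flag_flip P j A \<in> flags P" "flag_flip P j A \<noteq> A"
    "k \<in> {-1..n} \<Longrightarrow> k \<noteq> j \<Longrightarrow> face_at P (flag_flip P j A) k = face_at P A k"
    using B by auto
qed

lemma face_at_flip_same:
  assumes "A \<in> flags P" "0 \<le> j" "j < n"
  shows "face_at P (flag_flip P j A) j \<in> between j (face_at P A (j - 1)) (face_at P A (j + 1))"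
    and "face_at P (flag_flip P j A) j \<noteq> face_at P A j"
  using assms by (intro differing_face; auto simp: flag_flip_neq face_at_flip)+

lemma flag_flip_flip [simp]:
  "A \<in> flags P \<Longrightarrow> 0 \<le> j \<Longrightarrow> j < n \<Longrightarrow> flag_flip P j (flag_flip P j A) = A"
  by (rule flag_flip_eqI) (auto simp: face_at_flip dest: flag_flip_neq)

text \<open>Changing the i-face leaves the faces of ranks j - 1, j and j + 1 alone, so the j-flip
  chooses within the same two-element set before and after it.\<close>

lemma flag_flip_commute:
  assumes A: "A \<in> flags P" and i: "0 \<le> i" "i < n" and j: "0 \<le> j" "j < n" and ij: "\<bar>i - j\<bar> \<ge> 2"
  shows "flag_flip P i (flag_flip P j A) = flag_flip P j (flag_flip P i A)"
proof (rule flag_flip_eqI)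
  let ?B = "flag_flip P i A" and ?D = "flag_flip P j A"
  let ?C = "flag_flip P j ?B"
  have fl: "?B \<in> flags P" "?D \<in> flags P" "?C \<in> flags P" using assms by auto
  have ne: "i \<noteq> j" "j - 1 \<noteq> i" "j + 1 \<noteq> i" using ij by auto
  have "face_at P ?C i \<noteq> face_at P ?D i"
    using assms ne fl face_at_flip_same(2)[OF A i] by (simp add: face_at_flip)
  then show "?C \<noteq> ?D" by auto
  have "face_at P ?C j = face_at P ?D j"
  proof (rule between_unique[OF A j])
    show "face_at P ?C j \<in> between j (face_at P A (j - 1)) (face_at P A (j + 1))"
      using face_at_flip_same(1)[OF fl(1) j] i j A ne by (simp add: face_at_flip)
    show "face_at P ?C j \<noteq> face_at P A j"
      using face_at_flip_same(2)[OF fl(1) j] i j A ne by (simp add: face_at_flip)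
  qed (use face_at_flip_same[OF A j] in auto)
  moreover have "face_at P ?C k = face_at P ?D k" if "k \<in> {-1..n}" "k \<noteq> i" "k \<noteq> j" for k
    using that A fl i j by (simp add: face_at_flip)
  ultimately show "\<forall>k \<in> {-1..n} - {i}. face_at P ?C k = face_at P ?D k" by blast
qed (use assms in auto)

lemma face_at_bottom: "A \<in> flags P \<Longrightarrow> B \<in> flags P \<Longrightarrow> face_at P A (-1) = face_at P B (-1)"
proof -
  obtain L where L: "face_rank P L = -1" "\<And>G. G \<in> faces P \<Longrightarrow> (L, G) \<in> face_order P"
    using abstract_polytope by (auto simp: abstract_polytope_def)
  have "face_at P A (-1) = L" if "A \<in> flags P" for A
  proof -
    have "face_at P A (-1) \<in> faces P" "face_rank P (face_at P A (-1)) = -1"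
      using that by (auto simp: face_at_in face_at_rank intro!: subsetD[OF flag_subset_faces])
    then show ?thesis using L face_rank_less by fastforce
  qed
  then show "A \<in> flags P \<Longrightarrow> B \<in> flags P \<Longrightarrow> face_at P A (-1) = face_at P B (-1)" by simp
qed

lemma face_at_top: "A \<in> flags P \<Longrightarrow> B \<in> flags P \<Longrightarrow> face_at P A n = face_at P B n"
proof -
  obtain L where L: "face_rank P L = n" "\<And>G. G \<in> faces P \<Longrightarrow> (G, L) \<in> face_order P"
    using abstract_polytope by (auto simp: abstract_polytope_def)
  have "face_at P A n = L" if "A \<in> flags P" for A
  proof -
    have "face_at P A n \<in> faces P" "face_rank P (face_at P A n) = n"
      using that by (auto simp: face_at_in face_at_rank intro!: subsetD[OF flag_subset_faces])
    then show ?thesis using L face_rank_less by fastforce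
  qed
  then show "A \<in> flags P \<Longrightarrow> B \<in> flags P \<Longrightarrow> face_at P A n = face_at P B n" by simp
qed

lemma adjacent_flip:
  assumes "A \<in> flags P" "0 \<le> j" "j < n"
  shows "adjacent A (flag_flip P j A)"
proof -
  have *: "D - C = {face_at P D j}"
    if D: "D \<in> flags P" and C: "C \<in> flags P" and ne: "face_at P C j \<noteq> face_at P D j"
      and eq: "\<And>k. k \<in> {-1..n} \<Longrightarrow> k \<noteq> j \<Longrightarrow> face_at P C k = face_at P D k" for C D
  proof -
    have "face_at P D j \<in> D" "face_rank P (face_at P D j) = j"
      using D assms by (auto intro!: face_at_in face_at_rank)
    moreover from this have "face_at P D j \<notin> C" using face_at_eq[OF C, of "face_at P D j" j] ne by blast
    moreover have "F \<in> C" if "F \<in> D" "F \<noteq> face_at P D j" for F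
    proof -
      have "face_rank P F \<in> {-1..n}" "face_rank P F \<noteq> j"
        using that flag_ranks[OF D] face_at_eq[OF D, of F j] by auto
      then show ?thesis using eq[of "face_rank P F"] face_at_eq[OF D that(1)] face_at_in[OF C] by metis
    qed
    ultimately show ?thesis by blast
  qed
  show ?thesis
    using assms *[of A "flag_flip P j A"] *[of "flag_flip P j A" A] face_at_flip_same(2)[OF assms]
    by (auto simp: adjacent_def face_at_flip)
qed

text \<open>The least and the greatest face lie in every flag, so the differing face has a rank at
  which a flip exists.\<close>

lemma adjacent_imp_flip:
  assumes A: "A \<in> flags P" and B: "B \<in> flags P" and "adjacent A B"
  obtains j where "0 \<le> j" "j < n" "B = flag_flip P j A"
proof -
  obtain F where F: "A - B = {F}" using assms(3) by (auto simp: adjacent_def card_1_singleton_iff)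
  let ?j = "face_rank P F"
  have FA: "F \<in> A" "F \<notin> B" using F by auto
  have r: "?j \<in> {-1..n}" and fat: "face_at P A ?j = F"
    using FA flag_ranks[OF A] face_at_eq[OF A, of F] by blast+
  have "?j \<noteq> -1" "?j \<noteq> n"
    using face_at_bottom[OF A B] face_at_top[OF A B] fat FA face_at_in[OF B r] by metis+
  then have j: "0 \<le> ?j" "?j < n" using r by auto
  have "face_at P B k = face_at P A k" if k: "k \<in> {-1..n} - {?j}" for k
  proof (rule face_at_eq[OF B])
    show "face_rank P (face_at P A k) = k" using A k by (simp add: face_at_rank)
    then have "face_at P A k \<noteq> F" using k by auto
    then show "face_at P A k \<in> B" using F face_at_in[OF A] k by blast
  qed
  then have "flag_flip P ?j A = B"
    using FA by (intro flag_flip_eqI A B j) auto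
  then show ?thesis using that j by blast
qed

text \<open>A path of adjacent flags is a sequence of flips; connectedness thus becomes an induction
  principle.\<close>

lemma flag_induct:
  assumes A: "A \<in> flags P" and B: "B \<in> flags P" and Q: "Q A"
    and step: "\<And>C j. C \<in> flags P \<Longrightarrow> 0 \<le> j \<Longrightarrow> j < n \<Longrightarrow> Q C \<Longrightarrow> Q (flag_flip P j C)"
  shows "Q B"
proof -
  have "(A, B) \<in> {(C, D). C \<in> flags P \<and> D \<in> flags P \<and> adjacent C D \<and>
                       A \<inter> B \<subseteq> C \<and> A \<inter> B \<subseteq> D}\<^sup>*"
    using abstract_polytope A B by (simp add: abstract_polytope_def strongly_flag_connected_def)
  then show ?thesis
  proof induction
    case (step C D)
    then have "C \<in> flags P" "D \<in> flags P" "adjacent C D" "Q C" by auto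
    then show ?case using assms(4) adjacent_imp_flip by metis
  qed (rule Q)
qed

section \<open>Automorphisms\<close>

lemma aut_bij: "f \<in> poly_auts P \<Longrightarrow> bij_betw f (faces P) (faces P)"
  by (simp add: poly_auts_def)

lemma aut_inj_on_flag: "f \<in> poly_auts P \<Longrightarrow> A \<in> flags P \<Longrightarrow> inj_on f A"
  by (metis aut_bij bij_betw_def flag_subset_faces inj_on_subset)

lemma aut_order:
  "f \<in> poly_auts P \<Longrightarrow> F \<in> faces P \<Longrightarrow> G \<in> faces P \<Longrightarrow>
     (f F, f G) \<in> face_order P \<longleftrightarrow> (F, G) \<in> face_order P"
  by (simp add: poly_auts_def)

lemma aut_flag:
  assumes "f \<in> poly_auts P" "A \<in> flags P"
  shows "f ` A \<in> flags P"
proof -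
  have "f ` A \<in> Chains (face_order P)"
    using flag_chain[OF assms(2)] aut_order[OF assms(1)] flag_subset_faces[OF assms(2)]
    by (fastforce simp: Chains_def)
  then show ?thesis
    using assms by (simp add: flag_iff card_image[OF aut_inj_on_flag])
qed

text \<open>Automorphisms are only required to respect the order, so the rank is recovered here from
  the order alone. There are r + 2 ranks from -1 to r, whence the 2.\<close>

lemma face_rank_eq_card:
  assumes "A \<in> flags P" "F \<in> A"
  shows "face_rank P F = int (card {G \<in> A. (G, F) \<in> face_order P}) - 2"
proof -
  have "G \<in> A \<Longrightarrow> (G, F) \<in> face_order P \<longleftrightarrow> face_rank P G \<le> face_rank P F" for G
    using flag_le[OF assms(1) _ assms(2)] face_rank_less[of G F] by fastforce
  then have "{G \<in> A. (G, F) \<in> face_order P} = {G \<in> A. face_rank P G \<le> face_rank P F}" by blast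
  moreover have "face_rank P ` {G \<in> A. face_rank P G \<le> face_rank P F} = {-1..face_rank P F}"
    using flag_ranks[OF assms(1)] assms(2) by (auto simp: set_eq_iff image_iff) (metis order_trans)+
  moreover have "inj_on (face_rank P) {G \<in> A. face_rank P G \<le> face_rank P F}"
    using chain_rank_inj[OF flag_chain[OF assms(1)]] by (rule inj_on_subset) auto
  ultimately have "card {G \<in> A. (G, F) \<in> face_order P} = card {-1..face_rank P F}"
    using card_image[of "face_rank P" "{G \<in> A. face_rank P G \<le> face_rank P F}"] by simp
  moreover have "face_rank P F \<ge> -1"
    using assms flag_subset_faces face_rank_range by fastforce
  ultimately show ?thesis by simp
qed

lemma aut_rank:
  assumes f: "f \<in> poly_auts P" and A: "A \<in> flags P" and F: "F \<in> A"
  shows "face_rank P (f F) = face_rank P F"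
proof -
  have "{G \<in> f ` A. (G, f F) \<in> face_order P} = f ` {G \<in> A. (G, F) \<in> face_order P}"
    using aut_order[OF f] flag_subset_faces[OF A] F by blast
  moreover have "inj_on f {G \<in> A. (G, F) \<in> face_order P}"
    using aut_inj_on_flag[OF f A] by (rule inj_on_subset) auto
  ultimately show ?thesis
    using face_rank_eq_card[OF A F] face_rank_eq_card[OF aut_flag[OF f A], of "f F"] F
    by (simp add: card_image)
qed

lemma aut_face_at:
  assumes "f \<in> poly_auts P" "A \<in> flags P" "k \<in> {-1..n}"
  shows "face_at P (f ` A) k = f (face_at P A k)"
  using assms by (intro face_at_eq aut_flag) (auto simp: aut_rank face_at_in face_at_rank)

text \<open>An automorphism is injective and preserves ranks, so the images of \<open>A\<close> and
  of its j-flip are distinct and agree outside rank j; a flip is unique with this property.\<close>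

lemma aut_flip:
  assumes f: "f \<in> poly_auts P" and A: "A \<in> flags P" and j: "0 \<le> j" "j < n"
  shows "f ` flag_flip P j A = flag_flip P j (f ` A)"
proof (rule sym, rule flag_flip_eqI)
  show "f ` flag_flip P j A \<noteq> f ` A"
    using inj_on_image_eq_iff[of f "faces P" "flag_flip P j A" A] aut_bij[OF f]
      flag_subset_faces flag_flip_in[OF A j] A flag_flip_neq[OF A j]
    by (auto simp: bij_betw_def)
qed (use assms in \<open>auto simp: aut_flag aut_face_at face_at_flip\<close>)

text \<open>Automorphisms commute with all flips, so connectedness makes them determined by one flag.\<close>

lemma aut_eqI:
  assumes f: "f \<in> poly_auts P" and g: "g \<in> poly_auts P" and A: "A \<in> flags P" and fg: "f ` A = g ` A"
  shows "f = g"
proof (rule extensionalityI[of f "faces P" g])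
  fix F assume "F \<in> faces P"
  then obtain B where B: "B \<in> flags P" "F \<in> B" using face_in_flag by blast
  have "f ` B = g ` B"
    using A B(1) fg by (rule flag_induct) (simp add: aut_flip f g)
  moreover have "face_rank P F \<in> {-1..n}" "face_at P B (face_rank P F) = F"
    using B flag_ranks face_at_eq[of B F] by blast+
  ultimately show "f F = g F" using aut_face_at[OF f B(1)] aut_face_at[OF g B(1)] by metis
qed (use f g in \<open>auto simp: poly_auts_def\<close>)

end

section \<open>The automorphism group and its right action on flags\<close>

lemma Gamma_plus_sel [simp]:
  "carrier (Gamma_plus P) = poly_auts P" "\<one>\<^bsub>Gamma_plus P\<^esub> = (\<lambda>F \<in> faces P. F)"
  "f \<otimes>\<^bsub>Gamma_plus P\<^esub> g = compose (faces P) g f"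
  "num_gens (Gamma_plus P) = poly_rank P - 1" "gen (Gamma_plus P) = sigma P"
  by (simp_all add: Gamma_plus_def)

lemma group_Gamma_plus: "group (Gamma_plus P)"
proof (rule groupI, unfold Gamma_plus_sel)
  let ?S = "faces P"
  show "(\<lambda>F \<in> ?S. F) \<in> poly_auts P"
    by (auto simp: poly_auts_def bij_betw_def inj_on_def)
  fix f assume f: "f \<in> poly_auts P"
  then have bij: "bij_betw f ?S ?S" and ext: "f \<in> extensional ?S" and fS: "f \<in> ?S \<rightarrow> ?S"
    by (auto simp: poly_auts_def bij_betw_def)
  show "compose ?S f (\<lambda>F \<in> ?S. F) = f" by (rule compose_Id[OF fS ext])
  \<comment> \<open>The left inverse asked for is the map applied before \<open>f\<close>, and it is
    restricted because elements of \<open>poly_auts\<close> are extensional.\<close>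
  let ?g = "\<lambda>F \<in> ?S. inv_into ?S f F"
  have "?g \<in> poly_auts P"
  proof -
    have "bij_betw ?g ?S ?S" using bij_betw_inv_into[OF bij] by (simp cong: bij_betw_cong)
    moreover have "(?g F, ?g G) \<in> face_order P \<longleftrightarrow> (F, G) \<in> face_order P"
      if "F \<in> ?S" "G \<in> ?S" for F G
    proof -
      have "inv_into ?S f F \<in> ?S" "inv_into ?S f G \<in> ?S"
        using that bij by (auto simp: bij_betw_def inv_into_into)
      then have "(f (inv_into ?S f F), f (inv_into ?S f G)) \<in> face_order P \<longleftrightarrow>
          (inv_into ?S f F, inv_into ?S f G) \<in> face_order P"
        using f by (simp add: poly_auts_def)
      then show ?thesis using that by (simp add: bij_betw_inv_into_right[OF bij])
    qed
    ultimately show ?thesis by (simp add: poly_auts_def)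
  qed
  moreover have "compose ?S f ?g = (\<lambda>F \<in> ?S. F)"
    by (auto simp: compose_def bij_betw_inv_into_right[OF bij])
  ultimately show "\<exists>g\<in>poly_auts P. compose ?S f g = (\<lambda>F \<in> ?S. F)" by blast
  fix g assume g: "g \<in> poly_auts P"
  then have gS: "g \<in> ?S \<rightarrow> ?S" by (auto simp: poly_auts_def bij_betw_def)
  show "compose ?S g f \<in> poly_auts P"
    using f g fS bij_betw_compose[of f ?S ?S g ?S]
    by (auto simp: poly_auts_def compose_eq Pi_iff)
  fix h
  show "compose ?S h (compose ?S g f) = compose ?S (compose ?S h g) f"
    by (rule compose_assoc[OF fS])
qed

lemma finite_poly_auts: "finite (faces P) \<Longrightarrow> finite (poly_auts P)"
  by (rule finite_subset[OF _ finite_PiE[of "faces P" "\<lambda>_. faces P"]])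
    (auto simp: poly_auts_def PiE_def bij_betw_def)

context polytope
begin

abbreviation "\<Gamma> \<equiv> Gamma_plus P"

lemma aut_mult_image: "A \<in> flags P \<Longrightarrow> (f \<otimes>\<^bsub>\<Gamma>\<^esub> g) ` A = g ` f ` A"
  using flag_subset_faces[of A] unfolding image_image by (intro image_cong) (auto simp: compose_eq)

lemma aut_one_image: "A \<in> flags P \<Longrightarrow> \<one>\<^bsub>\<Gamma>\<^esub> ` A = A"
  using flag_subset_faces[of A] by force

lemma aut_inv_image:
  assumes "f \<in> poly_auts P" "A \<in> flags P" "f ` A = B"
  shows "(inv\<^bsub>\<Gamma>\<^esub> f) ` B = A"
proof -
  interpret group \<Gamma> by (rule group_Gamma_plus)
  have "(f \<otimes>\<^bsub>\<Gamma>\<^esub> inv\<^bsub>\<Gamma>\<^esub> f) ` A = \<one>\<^bsub>\<Gamma>\<^esub> ` A" using assms(1) by (subst r_inv) auto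
  then show ?thesis
    using assms by (simp only: aut_mult_image[OF assms(2)] aut_one_image[OF assms(2)])
qed

end

section \<open>Chiral polytopes\<close>

locale chiral = polytope +
  assumes chiral_polytope: "chiral_polytope P"
begin

abbreviation "\<Phi> \<equiv> base_flag P"

lemma base_flag: "\<Phi> \<in> flags P"
  using abstract_polytope by (simp add: abstract_polytope_def)

text \<open>There are two orbits, and both \<open>A\<close> and \<open>C\<close> avoid that of
  \<open>B\<close>, so they share the other one. This is how chirality produces
  automorphisms.\<close>

lemma two_step_orbit:
  assumes "A \<in> flags P" "B \<in> flags P" "C \<in> flags P" "adjacent B A" "adjacent B C"
  obtains f where "f \<in> poly_auts P" "f ` A = C"
proof -
  let ?o = "flag_orbit P"
  have "?o B \<noteq> ?o A" "?o B \<noteq> ?o C" "card (?o ` flags P) = 2"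
    using chiral_polytope assms by (auto simp: chiral_polytope_def)
  moreover obtain x y where "?o ` flags P = {x, y}"
    using \<open>card (?o ` flags P) = 2\<close> unfolding card_2_iff by blast
  moreover from this have "?o A \<in> {x, y}" "?o B \<in> {x, y}" "?o C \<in> {x, y}"
    using assms(1-3) by blast+
  ultimately have "?o A = ?o C" unfolding insert_iff empty_iff by metis
  moreover have "C \<in> ?o C"
  proof -
    interpret group \<Gamma> by (rule group_Gamma_plus)
    have "\<one>\<^bsub>\<Gamma>\<^esub> \<in> poly_auts P" using one_closed by simp
    then show ?thesis
      unfolding flag_orbit_def using aut_one_image[OF assms(3), symmetric] by blast
  qed
  ultimately have "C \<in> ?o A" by simp
  then show ?thesis using that by (auto simp: flag_orbit_def)
qed

text \<open>The description defining \<open>sigma\<close> is met: the flag with the i-face changed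
  is adjacent to the base flag and to the target, which yields existence, while an automorphism is
  determined by the image of one flag.\<close>

lemma
  assumes "1 \<le> i" "i \<le> poly_rank P - 1"
  shows sigma_closed: "sigma P i \<in> poly_auts P"
    and sigma_base_flag: "sigma P i ` \<Phi> = flag_flip P (int i - 1) (flag_flip P (int i) \<Phi>)"
proof -
  let ?B = "flag_flip P (int i) \<Phi>" and ?C = "flag_flip P (int i - 1) (flag_flip P (int i) \<Phi>)"
  have i: "0 \<le> int i" "int i < n" "0 \<le> int i - 1" "int i - 1 < n" using assms by auto
  have fl: "?B \<in> flags P" "?C \<in> flags P" using base_flag i by auto
  have "adjacent ?B \<Phi>"
    using adjacent_flip[OF fl(1) i(1,2)] base_flag i by simp
  moreover have "adjacent ?B ?C" using adjacent_flip[OF fl(1) i(3,4)] .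
  ultimately obtain f where f: "f \<in> poly_auts P" "f ` \<Phi> = ?C"
    using two_step_orbit base_flag fl by metis
  have "sigma P i = f"
    unfolding sigma_def using f aut_eqI[OF _ _ base_flag] by (intro the_equality) auto
  then show "sigma P i \<in> poly_auts P" "sigma P i ` \<Phi> = ?C" using f by auto
qed

lemma sigma_eqI:
  assumes "1 \<le> i" "i \<le> poly_rank P - 1" "f \<in> poly_auts P"
    "f ` \<Phi> = flag_flip P (int i - 1) (flag_flip P (int i) \<Phi>)"
  shows "sigma P i = f"
  using aut_eqI[OF sigma_closed[OF assms(1,2)] assms(3) base_flag] sigma_base_flag[OF assms(1,2)] assms(4)
  by simp

lemma sigma_image_closed: "sigma P ` {1..poly_rank P - 1} \<subseteq> carrier \<Gamma>"
  using sigma_closed by auto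

lemma gen_grp_Gamma_plus: "gen_grp \<Gamma>"
  using sigma_image_closed by (auto simp: gen_grp_def gen_grp_axioms_def group_Gamma_plus)

text \<open>Telescoping. Automorphisms commute with flips, so putting generator i in front of the
  product from i + 1 to j adds the flips i and i - 1, and flip i cancels the outer flip of the
  shorter product.\<close>

lemma sigma_product_base_flag:
  assumes "1 \<le> i" "i \<le> j" "j \<le> poly_rank P - 1"
  shows "word_eval \<Gamma> (sigma P) (map (\<lambda>k. (k, True)) [i..<Suc j]) ` \<Phi> =
    flag_flip P (int i - 1) (flag_flip P (int j) \<Phi>)"
  using assms(2,1)
proof (induction i rule: inc_induct)
  case base
  interpret group \<Gamma> by (rule group_Gamma_plus)
  have s: "sigma P j \<in> poly_auts P" using base assms(3) by (intro sigma_closed)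
  then have "word_eval \<Gamma> (sigma P) (map (\<lambda>k. (k, True)) [j..<Suc j]) = sigma P j"
    using r_one[of "sigma P j"] by simp
  then show ?case using sigma_base_flag base assms(3) by simp
next
  case (step i)
  interpret gen_grp \<Gamma> by (rule gen_grp_Gamma_plus)
  let ?s = "word_eval \<Gamma> (sigma P) (map (\<lambda>k. (k, True)) [Suc i..<Suc j])"
  have i: "1 \<le> i" "i \<le> poly_rank P - 1" and jn: "1 \<le> j" using step assms(3) by auto
  have "map (\<lambda>k. (k, True)) [Suc i..<Suc j] \<in> words_over {1..poly_rank P - 1}"
    using step assms(3) by (auto simp: words_over_def)
  from word_eval_closed[OF this sigma_image_closed] have s: "?s \<in> poly_auts P" by simp
  have "[i..<Suc j] = i # [Suc i..<Suc j]" using step by (simp add: upt_conv_Cons)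
  then have "word_eval \<Gamma> (sigma P) (map (\<lambda>k. (k, True)) [i..<Suc j]) ` \<Phi> = (sigma P i \<otimes>\<^bsub>\<Gamma>\<^esub> ?s) ` \<Phi>"
    by simp
  also have "\<dots> = ?s ` sigma P i ` \<Phi>" by (rule aut_mult_image[OF base_flag])
  also have "\<dots> = flag_flip P (int i - 1) (flag_flip P (int i) (?s ` \<Phi>))"
    using s i base_flag by (simp add: sigma_base_flag aut_flip)
  also have "?s ` \<Phi> = flag_flip P (int i) (flag_flip P (int j) \<Phi>)"
    using step by simp
  also have "flag_flip P (int i) (flag_flip P (int i) (flag_flip P (int j) \<Phi>)) = flag_flip P (int j) \<Phi>"
    using i base_flag jn assms(3) by simp
  finally show ?case .
qed

text \<open>The product acts on the base flag by flips j and i - 1, whose indices differ by at least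
  2 since i < j. These commute and are involutions, so the square fixes the base flag and is
  therefore trivial.\<close>

lemma Wplus_relators_hold:
  assumes "r \<in> Wplus_relators (poly_rank P)"
  shows "word_eval \<Gamma> (sigma P) r = \<one>\<^bsub>\<Gamma>\<^esub>"
proof -
  interpret gen_grp \<Gamma> by (rule gen_grp_Gamma_plus)
  obtain i j where ij: "1 \<le> i" "i < j" "j \<le> poly_rank P - 1"
    and r: "r = concat (replicate 2 (map (\<lambda>k. (k, True)) [i..<Suc j]))"
    using assms by (auto simp: Wplus_relators_def)
  define w where "w = map (\<lambda>k. (k, True)) [i..<Suc j]"
  have w: "w \<in> words_over {1..poly_rank P - 1}" using ij by (auto simp: w_def words_over_def)
  have r: "r = w @ w" by (simp add: r w_def numeral_2_eq_2)
  let ?s = "word_eval \<Gamma> (sigma P) w"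
  have s: "?s \<in> carrier \<Gamma>" using word_eval_closed[OF w sigma_image_closed] .
  have s\<Phi>: "?s ` \<Phi> = flag_flip P (int i - 1) (flag_flip P (int j) \<Phi>)"
    unfolding w_def using ij by (intro sigma_product_base_flag) auto
  have b: "0 \<le> int i - 1" "int i - 1 < n" "0 \<le> int j" "int j < n" "\<bar>int i - 1 - int j\<bar> \<ge> 2"
    using ij by auto
  have "(?s \<otimes>\<^bsub>\<Gamma>\<^esub> ?s) ` \<Phi> = ?s ` ?s ` \<Phi>" by (rule aut_mult_image[OF base_flag])
  also have "\<dots> = flag_flip P (int i - 1) (flag_flip P (int j) (?s ` \<Phi>))"
    unfolding s\<Phi> using s b base_flag by (simp add: aut_flip s\<Phi>)
  also have "\<dots> = \<Phi>"
    unfolding s\<Phi> using b base_flag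
    by (simp add: flag_flip_commute[of "flag_flip P (int j) \<Phi>" "int j" "int i - 1"])
  also have "\<dots> = \<one>\<^bsub>\<Gamma>\<^esub> ` \<Phi>" using aut_one_image[OF base_flag] by simp
  finally have "?s \<otimes>\<^bsub>\<Gamma>\<^esub> ?s = \<one>\<^bsub>\<Gamma>\<^esub>"
    using s m_closed[OF s s] one_closed by (intro aut_eqI[OF _ _ base_flag]) auto
  then show ?thesis using word_eval_append[OF w w sigma_image_closed] r by simp
qed

end

section \<open>Change of base flag, dual and mirror image\<close>

lemma rebase_sel [simp]:
  "flags (P\<lparr>base_flag := B\<rparr>) = flags P"
  "flag_flip (P\<lparr>base_flag := B\<rparr>) = flag_flip P"
  "poly_auts (P\<lparr>base_flag := B\<rparr>) = poly_auts P"
  "flag_orbit (P\<lparr>base_flag := B\<rparr>) = flag_orbit P"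
  by (simp_all add: flags_def flag_flip_def poly_auts_def flag_orbit_def fun_eq_iff)

lemma chiral_polytope_rebase:
  assumes "chiral_polytope P" "B \<in> flags P"
  shows "chiral_polytope (P\<lparr>base_flag := B\<rparr>)"
  using assms
  by (simp add: chiral_polytope_def abstract_polytope_def diamond_condition_def
      strongly_flag_connected_def)

lemma dual_sel [simp]:
  "faces (dual_polytope P) = faces P" "poly_rank (dual_polytope P) = poly_rank P"
  "base_flag (dual_polytope P) = base_flag P" "face_order (dual_polytope P) = (face_order P)\<inverse>"
  "flags (dual_polytope P) = flags P"
  "flag_flip (dual_polytope P) j = flag_flip P (int (poly_rank P) - 1 - j)"
  "poly_auts (dual_polytope P) = poly_auts P"
  "flag_orbit (dual_polytope P) = flag_orbit P"
proof -
  show s: "faces (dual_polytope P) = faces P" "poly_rank (dual_polytope P) = poly_rank P"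
    "base_flag (dual_polytope P) = base_flag P" "face_order (dual_polytope P) = (face_order P)\<inverse>"
    by (simp_all add: dual_polytope_def)
  have "Chains ((face_order P)\<inverse>) = Chains (face_order P)" by (auto simp: Chains_def)
  then show fl: "flags (dual_polytope P) = flags P" by (simp add: flags_def s)
  have "int (poly_rank P) - 1 - face_rank P F \<noteq> j \<longleftrightarrow> face_rank P F \<noteq> int (poly_rank P) - 1 - j" for F
    by auto
  then show "flag_flip (dual_polytope P) j = flag_flip P (int (poly_rank P) - 1 - j)"
    by (simp add: flag_flip_def fl fun_eq_iff) (simp add: dual_polytope_def)
  show au: "poly_auts (dual_polytope P) = poly_auts P" by (auto simp: poly_auts_def s)
  show "flag_orbit (dual_polytope P) = flag_orbit P" by (simp add: flag_orbit_def au fun_eq_iff)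
qed

lemma face_rank_dual [simp]: "face_rank (dual_polytope P) F = int (poly_rank P) - 1 - face_rank P F"
  by (simp add: dual_polytope_def)

lemma diamond_condition_dual:
  assumes "diamond_condition P"
  shows "diamond_condition (dual_polytope P)"
proof -
  let ?D = "dual_polytope P"
  have "card {H \<in> faces ?D. face_rank ?D H = face_rank ?D F + 1 \<and>
      (F, H) \<in> face_order ?D \<and> H \<noteq> F \<and> (H, G) \<in> face_order ?D \<and> H \<noteq> G} = 2"
    if FG: "(F, G) \<in> face_order ?D" and r: "face_rank ?D G = face_rank ?D F + 2" for F G
  proof -
    have "card {H \<in> faces P. face_rank P H = face_rank P G + 1 \<and>
        (G, H) \<in> face_order P \<and> H \<noteq> G \<and> (H, F) \<in> face_order P \<and> H \<noteq> F} = 2"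
      using assms FG r unfolding diamond_condition_def by fastforce
    moreover have "{H \<in> faces P. face_rank P H = face_rank P G + 1 \<and>
        (G, H) \<in> face_order P \<and> H \<noteq> G \<and> (H, F) \<in> face_order P \<and> H \<noteq> F} =
      {H \<in> faces ?D. face_rank ?D H = face_rank ?D F + 1 \<and>
        (F, H) \<in> face_order ?D \<and> H \<noteq> F \<and> (H, G) \<in> face_order ?D \<and> H \<noteq> G}"
      using r by auto
    ultimately show ?thesis by simp
  qed
  then show ?thesis unfolding diamond_condition_def by blast
qed

lemma chiral_polytope_dual:
  assumes "chiral_polytope P"
  shows "chiral_polytope (dual_polytope P)"
proof -
  have P: "abstract_polytope P" using assms by (simp add: chiral_polytope_def)
  have "strongly_flag_connected (dual_polytope P)"
    using P by (simp add: abstract_polytope_def strongly_flag_connected_def)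
  moreover have "diamond_condition (dual_polytope P)"
    using P by (simp add: abstract_polytope_def diamond_condition_dual)
  ultimately have "abstract_polytope (dual_polytope P)"
    using P unfolding abstract_polytope_def by auto
  then show ?thesis using assms by (simp add: chiral_polytope_def)
qed

lemma chiralI: "chiral_polytope P \<Longrightarrow> chiral P"
  by unfold_locales (simp_all add: chiral_polytope_def)

text \<open>Lets all words be evaluated in one group: the records differ in their distinguished
  generators, but the operations depend only on faces and automorphisms.\<close>

lemma
  assumes "faces Q = faces P" "poly_auts Q = poly_auts P"
  shows inv_Gamma_plus_cong: "m_inv (Gamma_plus Q) = m_inv (Gamma_plus P)"
    and word_eval_Gamma_plus_cong: "word_eval (Gamma_plus Q) x w = word_eval (Gamma_plus P) x w"
proof -
  show inv: "m_inv (Gamma_plus Q) = m_inv (Gamma_plus P)"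
    by (simp add: m_inv_def fun_eq_iff assms)
  show "word_eval (Gamma_plus Q) x w = word_eval (Gamma_plus P) x w"
    by (induction w) (simp_all add: inv assms)
qed

lemma mirror_sel [simp]:
  "faces (mirror_image P) = faces P" "poly_rank (mirror_image P) = poly_rank P"
  "poly_auts (mirror_image P) = poly_auts P" "flag_flip (mirror_image P) = flag_flip P"
  "base_flag (mirror_image P) = flag_flip P 0 (base_flag P)"
  by (simp_all add: mirror_image_def)

text \<open>Presents this polytope as the dual with a new base flag, to be compared with
  \<open>mirror_image (dual_polytope P)\<close>, where flip 0 of the dual is flip n - 1 of
  \<open>P\<close>.\<close>

lemma dual_mirror_image:
  "dual_polytope (mirror_image P) = (dual_polytope P)\<lparr>base_flag := flag_flip P 0 (base_flag P)\<rparr>"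
  by (simp add: mirror_image_def dual_polytope_def)

section \<open>Generators after dualizing, rebasing and mirroring; the bar map\<close>

context chiral
begin

lemma inv_sigma_base_flag:
  assumes "1 \<le> i" "i \<le> poly_rank P - 1"
  shows "(inv\<^bsub>\<Gamma>\<^esub> sigma P i) ` \<Phi> = flag_flip P (int i) (flag_flip P (int i - 1) \<Phi>)"
proof (rule aut_inv_image)
  show s: "sigma P i \<in> poly_auts P" by (rule sigma_closed[OF assms])
  have i: "0 \<le> int i - 1" "int i - 1 < n" "0 \<le> int i" "int i < n" using assms by auto
  show "flag_flip P (int i) (flag_flip P (int i - 1) \<Phi>) \<in> flags P" using base_flag i by simp
  show "sigma P i ` flag_flip P (int i) (flag_flip P (int i - 1) \<Phi>) = \<Phi>"
    using s i base_flag by (simp add: aut_flip sigma_base_flag[OF assms])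
qed

text \<open>Realizes delta. Flips i and i - 1 of the dual are flips m - 1 and m of \<open>P\<close>
  for m = n - i, performed in the order belonging to the inverse of generator m.\<close>

lemma sigma_dual:
  assumes "1 \<le> i" "i \<le> poly_rank P - 1"
  shows "sigma (dual_polytope P) i = inv\<^bsub>\<Gamma>\<^esub> sigma P (poly_rank P - i)"
proof -
  interpret D: chiral "dual_polytope P"
    by (rule chiralI[OF chiral_polytope_dual[OF chiral_polytope]])
  interpret G: group \<Gamma> by (rule group_Gamma_plus)
  let ?m = "poly_rank P - i"
  have m: "1 \<le> ?m" "?m \<le> poly_rank P - 1" "int ?m = n - int i" using assms by auto
  show ?thesis
  proof (rule D.sigma_eqI)
    show "inv\<^bsub>\<Gamma>\<^esub> sigma P ?m \<in> poly_auts (dual_polytope P)"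
      using G.inv_closed sigma_closed[OF m(1,2)] by simp
    show "(inv\<^bsub>\<Gamma>\<^esub> sigma P ?m) ` base_flag (dual_polytope P) =
       flag_flip (dual_polytope P) (int i - 1)
        (flag_flip (dual_polytope P) (int i) (base_flag (dual_polytope P)))"
      using inv_sigma_base_flag[OF m(1,2)] m(3) by (simp add: algebra_simps)
  qed (use assms in auto)
qed

text \<open>Under the right action the conjugate first returns to the old base flag, then applies
  the generator, then moves forward by \<open>h\<close>, which commutes with flips.\<close>

lemma sigma_rebase:
  assumes "1 \<le> i" "i \<le> poly_rank P - 1" "h \<in> poly_auts P"
  shows "sigma (P\<lparr>base_flag := h ` \<Phi>\<rparr>) i = inv\<^bsub>\<Gamma>\<^esub> h \<otimes>\<^bsub>\<Gamma>\<^esub> sigma P i \<otimes>\<^bsub>\<Gamma>\<^esub> h"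
proof -
  have h\<Phi>: "h ` \<Phi> \<in> flags P" using aut_flag[OF assms(3) base_flag] .
  interpret Q: chiral "P\<lparr>base_flag := h ` \<Phi>\<rparr>"
    by (rule chiralI[OF chiral_polytope_rebase[OF chiral_polytope h\<Phi>]])
  interpret G: group \<Gamma> by (rule group_Gamma_plus)
  have s: "sigma P i \<in> carrier \<Gamma>" and h: "h \<in> carrier \<Gamma>"
    using assms sigma_closed by auto
  show ?thesis
  proof (rule Q.sigma_eqI)
    show "inv\<^bsub>\<Gamma>\<^esub> h \<otimes>\<^bsub>\<Gamma>\<^esub> sigma P i \<otimes>\<^bsub>\<Gamma>\<^esub> h \<in> poly_auts (P\<lparr>base_flag := h ` \<Phi>\<rparr>)"
      using G.m_closed[OF G.m_closed[OF G.inv_closed[OF h] s] h] by simp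
    have "(inv\<^bsub>\<Gamma>\<^esub> h \<otimes>\<^bsub>\<Gamma>\<^esub> sigma P i \<otimes>\<^bsub>\<Gamma>\<^esub> h) ` h ` \<Phi> = h ` sigma P i ` (inv\<^bsub>\<Gamma>\<^esub> h) ` h ` \<Phi>"
      by (simp only: aut_mult_image[OF h\<Phi>])
    also have "\<dots> = h ` sigma P i ` \<Phi>"
      using aut_inv_image[OF assms(3) base_flag refl] by simp
    also have "\<dots> = flag_flip P (int i - 1) (flag_flip P (int i) (h ` \<Phi>))"
      using assms base_flag by (simp add: sigma_base_flag aut_flip)
    finally show "(inv\<^bsub>\<Gamma>\<^esub> h \<otimes>\<^bsub>\<Gamma>\<^esub> sigma P i \<otimes>\<^bsub>\<Gamma>\<^esub> h) ` base_flag (P\<lparr>base_flag := h ` \<Phi>\<rparr>) =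
      flag_flip (P\<lparr>base_flag := h ` \<Phi>\<rparr>) (int i - 1)
        (flag_flip (P\<lparr>base_flag := h ` \<Phi>\<rparr>) (int i) (base_flag (P\<lparr>base_flag := h ` \<Phi>\<rparr>)))"
      by simp
  qed (use assms in auto)
qed

lemma chiral_mirror_image: "poly_rank P \<ge> 1 \<Longrightarrow> chiral (mirror_image P)"
  unfolding mirror_image_def using base_flag
  by (intro chiralI chiral_polytope_rebase[OF chiral_polytope]) simp

text \<open>Explains the formulas for the bar: the images of the generators are the automorphisms
  acting as generators at the flag with the 0-face changed. From i = 3 on, flip 0 commutes with both
  flips involved.\<close>

lemma sigma_mirror:
  assumes i: "1 \<le> i" "i \<le> poly_rank P - 1"
  shows "sigma (mirror_image P) i =
    (if i = 1 then inv\<^bsub>\<Gamma>\<^esub> sigma P 1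
     else if i = 2 then (sigma P 1 [^]\<^bsub>\<Gamma>\<^esub> (2::nat)) \<otimes>\<^bsub>\<Gamma>\<^esub> sigma P 2
     else sigma P i)" (is "_ = ?f")
proof -
  interpret M: chiral "mirror_image P" using i by (intro chiral_mirror_image) auto
  interpret G: group \<Gamma> by (rule group_Gamma_plus)
  have s1: "sigma P 1 \<in> carrier \<Gamma>" using i sigma_closed by simp
  have flip_i: "flag_flip P j A \<in> flags P" if "A \<in> flags P" "0 \<le> j" "j \<le> int i" for A j
    using that i by simp
  have base: "flag_flip P 0 \<Phi> \<in> flags P" using base_flag i by (intro flip_i) auto
  have "?f \<in> poly_auts P \<and>
      ?f ` flag_flip P 0 \<Phi> = flag_flip P (int i - 1) (flag_flip P (int i) (flag_flip P 0 \<Phi>))"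
  proof -
    consider "i = 1" | "i = 2" | "i \<ge> 3" using i by linarith
    then show ?thesis
    proof cases
      case 1
      have inv: "inv\<^bsub>\<Gamma>\<^esub> sigma P 1 \<in> poly_auts P" using G.inv_closed[OF s1] by simp
      have "(inv\<^bsub>\<Gamma>\<^esub> sigma P 1) ` flag_flip P 0 \<Phi> = flag_flip P 0 ((inv\<^bsub>\<Gamma>\<^esub> sigma P 1) ` \<Phi>)"
        using i by (intro aut_flip inv base_flag) auto
      then show ?thesis using 1 i inv inv_sigma_base_flag[of 1] by simp
    next
      case 2
      have s2: "sigma P 2 \<in> carrier \<Gamma>" using i 2 sigma_closed by simp
      have n: "2 < n" using i 2 by auto
      have pow: "sigma P 1 [^]\<^bsub>\<Gamma>\<^esub> (2::nat) = sigma P 1 \<otimes>\<^bsub>\<Gamma>\<^esub> sigma P 1"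
        using G.l_one[OF s1] by (simp add: numeral_2_eq_2 del: Gamma_plus_sel)
      have f: "?f = sigma P 1 \<otimes>\<^bsub>\<Gamma>\<^esub> sigma P 1 \<otimes>\<^bsub>\<Gamma>\<^esub> sigma P 2"
        unfolding pow[symmetric] using 2 by (simp del: Gamma_plus_sel)
      have cl: "?f \<in> poly_auts P"
        unfolding f using G.m_closed[OF G.m_closed[OF s1 s1] s2] by simp
      have s1': "sigma P 1 \<in> poly_auts P" and s2': "sigma P 2 \<in> poly_auts P" using s1 s2 by auto
      have b1: "sigma P 1 ` \<Phi> = flag_flip P 0 (flag_flip P 1 \<Phi>)"
        and b2: "sigma P 2 ` \<Phi> = flag_flip P 1 (flag_flip P 2 \<Phi>)"
        using sigma_base_flag[of 1] sigma_base_flag[of 2] i 2 by auto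
      have "?f ` flag_flip P 0 \<Phi> = sigma P 2 ` sigma P 1 ` sigma P 1 ` flag_flip P 0 \<Phi>"
        unfolding f by (simp only: aut_mult_image[OF base])
      \<comment> \<open>Each automorphism is pushed inwards through the flips until it meets the
        base flag; repeated flips then cancel, and flips 0 and 2 commute.\<close>
      also have "\<dots> = flag_flip P 0 (flag_flip P 0 (flag_flip P 1 (flag_flip P 0 (flag_flip P 1
          (flag_flip P 1 (flag_flip P 2 \<Phi>))))))"
        using n s1' s2' base_flag by (simp add: aut_flip b1 b2 del: One_nat_def)
      also have "\<dots> = flag_flip P 1 (flag_flip P 0 (flag_flip P 2 \<Phi>))"
        using n base_flag by simp
      also have "flag_flip P 0 (flag_flip P 2 \<Phi>) = flag_flip P 2 (flag_flip P 0 \<Phi>)"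
        using n base_flag by (intro flag_flip_commute) auto
      finally show ?thesis using cl 2 by simp
    next
      case 3
      have b: "0 \<le> int i - 1" "int i - 1 < n" "0 \<le> int i" "int i < n" "0 < n"
        using i by auto
      have "sigma P i ` flag_flip P 0 \<Phi> = flag_flip P 0 (flag_flip P (int i - 1) (flag_flip P (int i) \<Phi>))"
        using b base_flag sigma_closed[OF i] by (simp add: aut_flip sigma_base_flag[OF i])
      also have "\<dots> = flag_flip P (int i - 1) (flag_flip P 0 (flag_flip P (int i) \<Phi>))"
        using b base_flag 3 by (intro flag_flip_commute) auto
      also have "flag_flip P 0 (flag_flip P (int i) \<Phi>) = flag_flip P (int i) (flag_flip P 0 \<Phi>)"
        using b base_flag 3 by (intro flag_flip_commute) auto
      finally show ?thesis using 3 sigma_closed[OF i] by simp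
    qed
  qed
  then show ?thesis using i by (intro M.sigma_eqI) (auto simp del: Gamma_plus_sel)
qed

text \<open>Reading the bar of an element in the group of \<open>P\<close> is the same as reading
  the element in the mirror image, since both homomorphisms agree on generators.\<close>

lemma subst_gens_Wplus_bar:
  assumes w: "w \<in> words_over {1..poly_rank P - 1}" and rank: "poly_rank P \<ge> 2"
  defines "A \<equiv> pres_class {1..poly_rank P - 1} (Wplus_relators (poly_rank P)) w"
  shows "Wplus_bar (poly_rank P) A \<in> carrier (Wplus (poly_rank P))"
    and "subst_gens \<Gamma> (sigma P) (Wplus_bar (poly_rank P) A) = word_eval \<Gamma> (sigma (mirror_image P)) w"
proof -
  let ?n = "poly_rank P" and ?X = "{1..poly_rank P - 1}" and ?R = "Wplus_relators (poly_rank P)"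
  let ?W = "Wplus ?n"
  interpret M: chiral "mirror_image P" using rank by (intro chiral_mirror_image) auto
  interpret G: group \<Gamma> by (rule group_Gamma_plus)
  interpret W: group ?W unfolding Wplus_def by (rule group_presented_group)
  interpret psi: group_hom ?W \<Gamma> "subst_gens \<Gamma> (sigma P)"
    unfolding Wplus_def using Wplus_relators_hold by (intro G.subst_gens_hom sigma_image_closed) auto
  define y where "y i = (if i = 1 then inv\<^bsub>?W\<^esub> (Wplus_gen ?n 1)
          else if i = 2 then (Wplus_gen ?n 1 [^]\<^bsub>?W\<^esub> (2::nat)) \<otimes>\<^bsub>?W\<^esub> Wplus_gen ?n 2
          else Wplus_gen ?n i)" for i
  have gen: "Wplus_gen ?n i \<in> carrier ?W" if "i \<in> ?X" for i
    using that by (simp add: Wplus_gen_def Wplus_def)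
  have X1: "1 \<in> ?X" using rank by auto
  have y: "y ` ?X \<subseteq> carrier ?W" using gen X1 by (auto simp: y_def)
  have psi_gen: "subst_gens \<Gamma> (sigma P) (Wplus_gen ?n i) = sigma P i" if "i \<in> ?X" for i
  proof -
    have "sigma P i \<in> carrier \<Gamma>" using sigma_image_closed that by blast
    moreover have "subst_gens \<Gamma> (sigma P) (Wplus_gen ?n i) = word_eval \<Gamma> (sigma P) [(i, True)]"
      unfolding Wplus_gen_def using that Wplus_relators_hold
      by (intro G.subst_gens_pres_class[OF _ sigma_image_closed]) auto
    ultimately show ?thesis using G.r_one by (simp del: Gamma_plus_sel)
  qed
  have psi_y: "(subst_gens \<Gamma> (sigma P) \<circ> y) i = sigma (mirror_image P) i" if "i \<in> ?X" for i
    using that X1 gen psi_gen sigma_mirror[of i]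
    by (auto simp: y_def psi.hom_nat_pow simp del: Gamma_plus_sel)
  \<comment> \<open>\<open>Wplus_bar\<close> evaluates a representative chosen from
    \<open>A\<close>. Independence of the choice is obtained inside \<open>\<Gamma>\<close>, where
    the mirror generators satisfy the relators of W+.\<close>
  define w' where "w' = (SOME v. v \<in> A)"
  have "w \<in> A" using w by (auto simp: A_def intro: pres_refl)
  then have "w' \<in> A" unfolding w'_def by (rule someI)
  then have ww': "(w, w') \<in> pres_rel ?X ?R" by (simp add: A_def)
  then have w': "w' \<in> words_over ?X" using equiv_type[OF equiv_pres_rel] by blast
  have bar: "Wplus_bar ?n A = word_eval ?W y w'"
    by (simp add: Wplus_bar_def subst_gens_def w'_def y_def[abs_def])
  show "Wplus_bar ?n A \<in> carrier ?W" unfolding bar by (rule W.word_eval_closed[OF w' y])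
  have "subst_gens \<Gamma> (sigma P) (Wplus_bar ?n A) = word_eval \<Gamma> (subst_gens \<Gamma> (sigma P) \<circ> y) w'"
    unfolding bar by (rule psi.word_eval_hom[OF w' y])
  also have "\<dots> = word_eval \<Gamma> (sigma (mirror_image P)) w'"
    by (rule word_eval_cong[OF w' psi_y])
  also have "\<dots> = word_eval \<Gamma> (sigma (mirror_image P)) w"
    using M.Wplus_relators_hold M.sigma_image_closed
    by (intro G.word_eval_pres_rel[OF pres_sym[OF ww']])
      (simp_all add: word_eval_Gamma_plus_cong[of "mirror_image P" P])
  finally show "subst_gens \<Gamma> (sigma P) (Wplus_bar ?n A) = word_eval \<Gamma> (sigma (mirror_image P)) w" .
qed

end

section \<open>Consequences of bar-invariance of the kernel of the mix\<close>

context chiral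
begin

text \<open>Invariance puts the bar of \<open>w\<close> into the kernel N again. Its reading in
  \<open>P\<close> says that \<open>w\<close> is trivial in the mirror image, its reading in the
  dual that \<open>w\<close> is trivial in the mirror image of the dual; a conjugation passes to the
  dual of the mirror image.\<close>

lemma kernel_mirror_of_not_mix_chiral:
  assumes not_chiral: "\<not> mix_chiral P (dual_polytope P)"
    and w: "w \<in> words_over {1..poly_rank P - 1}"
    and wP: "word_eval \<Gamma> (sigma P) w = \<one>\<^bsub>\<Gamma>\<^esub>"
    and wD: "word_eval \<Gamma> (sigma (dual_polytope P)) w = \<one>\<^bsub>\<Gamma>\<^esub>"
  shows "word_eval \<Gamma> (sigma (mirror_image P)) w = \<one>\<^bsub>\<Gamma>\<^esub>"
    and "word_eval \<Gamma> (sigma (dual_polytope (mirror_image P))) w = \<one>\<^bsub>\<Gamma>\<^esub>"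
proof -
  let ?n = "poly_rank P" and ?X = "{1..poly_rank P - 1}" and ?R = "Wplus_relators (poly_rank P)"
  let ?D = "dual_polytope P"
  have "word_eval \<Gamma> (sigma (mirror_image P)) w = \<one>\<^bsub>\<Gamma>\<^esub> \<and>
    word_eval \<Gamma> (sigma (dual_polytope (mirror_image P))) w = \<one>\<^bsub>\<Gamma>\<^esub>"
  proof (cases "?n \<ge> 2")
    \<comment> \<open>Subtraction is truncated, so below rank 2 the index set is empty and only the
      empty word remains.\<close>
    case False
    then have "w = []" using w by (cases w) auto
    then show ?thesis by simp
  next
    case True
    interpret G: group \<Gamma> by (rule group_Gamma_plus)
    interpret D: chiral ?D by (rule chiralI[OF chiral_polytope_dual[OF chiral_polytope]])
    interpret MD: chiral "mirror_image ?D" using True by (intro D.chiral_mirror_image) auto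
    have evD: "word_eval D.\<Gamma> x v = word_eval \<Gamma> x v" for x :: "nat \<Rightarrow> _" and v
      by (rule word_eval_Gamma_plus_cong) auto
    let ?G = "\<Gamma> \<diamond> D.\<Gamma>"
    have gg: "gen_grp \<Gamma>" "gen_grp D.\<Gamma>" "num_gens D.\<Gamma> = num_gens \<Gamma>"
      by (simp_all add: gen_grp_Gamma_plus D.gen_grp_Gamma_plus)
    interpret Mix: generated_grp ?G by (rule generated_grp_mix[OF gg])
    have ev: "word_eval ?G (gen ?G) v = (word_eval \<Gamma> (sigma P) v, word_eval D.\<Gamma> (sigma ?D) v)"
      if "v \<in> words_over ?X" for v
      using word_eval_mix[OF gg, of v] that by simp
    have rel: "word_eval ?G (gen ?G) r = \<one>\<^bsub>?G\<^esub>" if "r \<in> ?R" "r \<in> words_over ?X" for r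
      using ev[OF that(2)] Wplus_relators_hold[OF that(1)] D.Wplus_relators_hold[of r] that(1) by simp
    have subst: "subst_gens ?G (gen ?G) (pres_class ?X ?R v) =
        (word_eval \<Gamma> (sigma P) v, word_eval D.\<Gamma> (sigma ?D) v)" if "v \<in> words_over ?X" for v
      using Mix.subst_gens_pres_class[OF that _ rel] Mix.gen_closed ev[OF that] by simp
    define N where "N = Wplus_kernel ?n ?G"
    have inv: "Wplus_bar ?n ` N = N"
      using not_chiral by (simp add: mix_chiral_def Let_def N_def)
    let ?A = "pres_class ?X ?R w"
    have "?A \<in> N"
      using w wP wD subst[OF w] by (simp add: N_def Wplus_kernel_def kernel_def Wplus_def evD)
    then have barN: "Wplus_bar ?n ?A \<in> N" using inv by blast
    then have "Wplus_bar ?n ?A \<in> carrier (Wplus ?n)"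
      by (simp add: N_def Wplus_kernel_def kernel_def)
    then obtain v where v: "v \<in> words_over ?X" "Wplus_bar ?n ?A = pres_class ?X ?R v"
      by (auto simp: Wplus_def carrier_presented_group)
    have "subst_gens ?G (gen ?G) (pres_class ?X ?R v) = \<one>\<^bsub>?G\<^esub>"
      using barN unfolding v(2) by (simp add: N_def Wplus_kernel_def kernel_def)
    then have vP: "word_eval \<Gamma> (sigma P) v = \<one>\<^bsub>\<Gamma>\<^esub>" and vD: "word_eval D.\<Gamma> (sigma ?D) v = \<one>\<^bsub>D.\<Gamma>\<^esub>"
      unfolding subst[OF v(1)] by (simp_all del: Gamma_plus_sel)
    have "subst_gens \<Gamma> (sigma P) (Wplus_bar ?n ?A) = word_eval \<Gamma> (sigma P) v"
      unfolding v(2) by (rule G.subst_gens_pres_class[OF v(1) sigma_image_closed Wplus_relators_hold])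
    then have P1: "word_eval \<Gamma> (sigma (mirror_image P)) w = \<one>\<^bsub>\<Gamma>\<^esub>"
      using subst_gens_Wplus_bar(2)[OF w True] vP by simp
    interpret GD: group D.\<Gamma> by (rule group_Gamma_plus)
    have "subst_gens D.\<Gamma> (sigma ?D) (Wplus_bar ?n ?A) = word_eval D.\<Gamma> (sigma ?D) v"
      unfolding v(2) using v(1) D.sigma_image_closed D.Wplus_relators_hold
      by (intro GD.subst_gens_pres_class) auto
    then have D1: "word_eval \<Gamma> (sigma (mirror_image ?D)) w = \<one>\<^bsub>\<Gamma>\<^esub>"
      using D.subst_gens_Wplus_bar(2)[of w] w True vD by (simp add: evD)
    \<comment> \<open>The base flags of \<open>mirror_image (dual_polytope P)\<close> and \<open>dual_polytope (mirror_image P)\<close>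
      are both adjacent to the base flag of \<open>P\<close>, hence lie in one orbit.\<close>
    let ?Psi = "flag_flip P (n - 1) \<Phi>"
    have "?Psi \<in> flags P" "flag_flip P 0 \<Phi> \<in> flags P" "adjacent \<Phi> ?Psi" "adjacent \<Phi> (flag_flip P 0 \<Phi>)"
      using base_flag True by (auto intro!: adjacent_flip)
    then obtain h where h: "h \<in> poly_auts P" "h ` ?Psi = flag_flip P 0 \<Phi>"
      using two_step_orbit[OF _ base_flag] by metis
    have DM: "dual_polytope (mirror_image P) =
        (mirror_image ?D)\<lparr>base_flag := h ` base_flag (mirror_image ?D)\<rparr>"
      using h(2) by (simp add: dual_mirror_image) (simp add: mirror_image_def)
    have conj: "sigma (dual_polytope (mirror_image P)) i =
        inv\<^bsub>\<Gamma>\<^esub> h \<otimes>\<^bsub>\<Gamma>\<^esub> sigma (mirror_image ?D) i \<otimes>\<^bsub>\<Gamma>\<^esub> h" if "i \<in> ?X" for i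
      unfolding DM using MD.sigma_rebase[of i h] that h(1)
      by (simp add: inv_Gamma_plus_cong[of "mirror_image ?D" P])
    have hG: "h \<in> carrier \<Gamma>" using h by simp
    have "word_eval \<Gamma> (sigma (dual_polytope (mirror_image P))) w =
        word_eval \<Gamma> (\<lambda>i. inv\<^bsub>\<Gamma>\<^esub> h \<otimes>\<^bsub>\<Gamma>\<^esub> sigma (mirror_image ?D) i \<otimes>\<^bsub>\<Gamma>\<^esub> h) w"
      by (rule word_eval_cong[OF w conj])
    also have "\<dots> = inv\<^bsub>\<Gamma>\<^esub> h \<otimes>\<^bsub>\<Gamma>\<^esub> word_eval \<Gamma> (sigma (mirror_image ?D)) w \<otimes>\<^bsub>\<Gamma>\<^esub> h"
      using MD.sigma_image_closed by (intro G.word_eval_conjugate[OF w _ hG]) simp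
    also have "\<dots> = \<one>\<^bsub>\<Gamma>\<^esub>" unfolding D1 using hG by (simp del: Gamma_plus_sel)
    finally show ?thesis using P1 by simp
  qed
  then show "word_eval \<Gamma> (sigma (mirror_image P)) w = \<one>\<^bsub>\<Gamma>\<^esub>"
    and "word_eval \<Gamma> (sigma (dual_polytope (mirror_image P))) w = \<one>\<^bsub>\<Gamma>\<^esub>" by auto
qed

end

text \<open>In rank at most 1 there are no generators, so the mirror image, whose base flag may then be
  a junk value, need not be a polytope.\<close>

lemma gen_grp_Gamma_plus_mirror:
  assumes "chiral_polytope P"
  shows "gen_grp (Gamma_plus (mirror_image P))"
    and "gen_grp (Gamma_plus (dual_polytope (mirror_image P)))"
proof -
  interpret chiral P by (rule chiralI[OF assms])
  have "gen_grp (Gamma_plus (mirror_image P)) \<and>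
    gen_grp (Gamma_plus (dual_polytope (mirror_image P)))"
  proof (cases "poly_rank P \<ge> 1")
    case True
    interpret M: chiral "mirror_image P" using True by (rule chiral_mirror_image)
    interpret MD: chiral "dual_polytope (mirror_image P)"
      by (rule chiralI[OF chiral_polytope_dual[OF M.chiral_polytope]])
    show ?thesis using M.gen_grp_Gamma_plus MD.gen_grp_Gamma_plus by blast
  qed (auto simp: gen_grp_def gen_grp_axioms_def group_Gamma_plus)
  then show "gen_grp (Gamma_plus (mirror_image P))"
    "gen_grp (Gamma_plus (dual_polytope (mirror_image P)))" by auto
qed

text \<open>As pairs of automorphisms, the generators of the dual mix are the inverses of the
  original ones in reversed order. Inclusion of carriers yields the comparison of orders used in the
  final count.\<close>

lemma carrier_mix_mirror_subset_dual:
  assumes "chiral_polytope P"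
  shows "carrier (Gamma_plus P \<diamond> Gamma_plus (mirror_image P)) \<subseteq>
    carrier (Gamma_plus (dual_polytope P) \<diamond> Gamma_plus (dual_polytope (mirror_image P)))"
proof -
  interpret chiral P by (rule chiralI[OF assms])
  let ?M = "mirror_image P" and ?X = "{1..poly_rank P - 1}"
  let ?GD = "Gamma_plus (dual_polytope P)" and ?GDM = "Gamma_plus (dual_polytope (mirror_image P))"
  interpret D: chiral "dual_polytope P"
    by (rule chiralI[OF chiral_polytope_dual[OF chiral_polytope]])
  have gg: "gen_grp ?GD" "gen_grp ?GDM" "num_gens ?GDM = num_gens ?GD"
    using gen_grp_Gamma_plus_mirror[OF assms] D.gen_grp_Gamma_plus by simp_all
  interpret G: group \<Gamma> by (rule group_Gamma_plus)
  interpret GM: group "Gamma_plus ?M" by (rule group_Gamma_plus)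
  interpret Mix: generated_grp "?GD \<diamond> ?GDM" by (rule generated_grp_mix[OF gg])
  have gens: "(sigma P i, sigma ?M i) \<in> carrier (?GD \<diamond> ?GDM)" if i: "i \<in> ?X" for i
  proof -
    interpret M: chiral ?M using i by (intro chiral_mirror_image) auto
    \<comment> \<open>The inverse of generator number n - i of the dual mix is generator number i of
      the original mix.\<close>
    let ?j = "poly_rank P - i"
    have j: "?j \<in> ?X" "poly_rank P - ?j = i" using i by auto
    have "gen (?GD \<diamond> ?GDM) ?j \<in> carrier (?GD \<diamond> ?GDM)"
      using j Mix.gen_closed by (auto simp: image_subset_iff)
    then have mem: "(inv\<^bsub>\<Gamma>\<^esub> sigma P i, inv\<^bsub>M.\<Gamma>\<^esub> sigma ?M i) \<in> carrier (?GD \<diamond> ?GDM)"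
      using sigma_dual[of ?j] M.sigma_dual[of ?j] j by simp
    have "inv\<^bsub>?GD \<diamond> ?GDM\<^esub> (inv\<^bsub>\<Gamma>\<^esub> sigma P i, inv\<^bsub>M.\<Gamma>\<^esub> sigma ?M i) = (sigma P i, sigma ?M i)"
      using inv_mix[OF gg mem] G.inv_inv[of "sigma P i"] GM.inv_inv[of "sigma ?M i"]
        sigma_closed[of i] M.sigma_closed[of i] i
      by (simp add: inv_Gamma_plus_cong[of "dual_polytope P" P]
          inv_Gamma_plus_cong[of "dual_polytope ?M" ?M])
    then show ?thesis using Mix.inv_closed[OF mem] by simp
  qed
  have invs: "(inv\<^bsub>\<Gamma>\<^esub> a, inv\<^bsub>Gamma_plus ?M\<^esub> b) = inv\<^bsub>?GD \<diamond> ?GDM\<^esub> (a, b)"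
    if "(a, b) \<in> carrier (?GD \<diamond> ?GDM)" for a b
    using inv_mix[OF gg that] by (simp add: inv_Gamma_plus_cong[of "dual_polytope P" P]
          inv_Gamma_plus_cong[of "dual_polytope ?M" ?M])
  have "x \<in> carrier (?GD \<diamond> ?GDM)"
    if "x \<in> generate (\<Gamma> \<times>\<times> Gamma_plus ?M) ((\<lambda>i. (sigma P i, sigma ?M i)) ` ?X)" for x
    using that
  proof induction
    case one
    then show ?case using Mix.one_closed by simp
  next
    case (incl x)
    then show ?case using gens by auto
  next
    case (inv x)
    then obtain i where i: "i \<in> ?X" "x = (sigma P i, sigma ?M i)" by auto
    have "sigma P i \<in> carrier \<Gamma>" "sigma ?M i \<in> carrier (Gamma_plus ?M)"
      using carrier_mix_subset[OF gg] gens[OF i(1)] by auto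
    then have "inv\<^bsub>\<Gamma> \<times>\<times> Gamma_plus ?M\<^esub> x = inv\<^bsub>?GD \<diamond> ?GDM\<^esub> x"
      using i(2) invs[OF gens[OF i(1)]] inv_DirProd[OF G.is_group GM.is_group] by simp
    then show ?case using Mix.inv_closed[OF gens[OF i(1)]] i(2) by simp
  next
    case (eng x y)
    obtain a b c d where "x = (a, b)" "y = (c, d)" by (metis surj_pair)
    then show ?case using Mix.m_closed[of x y] eng by simp
  qed
  then show ?thesis by (auto simp: mix_def)
qed

section \<open>The count of orders\<close>

theorem theorem5p4:
  fixes P :: "'a polytope_data"
  assumes "chiral_polytope P"
    and "finite (faces P)"
    and "(real (order (Gamma_plus P \<diamond> Gamma_plus (mirror_image P))) / real (order (Gamma_plus P)))\<^sup>2
          > real (order ((Gamma_plus P \<diamond> Gamma_plus (mirror_image P)) \<box>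
                (Gamma_plus (dual_polytope P) \<diamond> Gamma_plus (dual_polytope (mirror_image P)))))"
  shows "mix_chiral P (dual_polytope P)"
proof (rule ccontr)
  assume not_chiral: "\<not> mix_chiral P (dual_polytope P)"
  interpret chiral P by (rule chiralI[OF assms(1)])
  interpret D: chiral "dual_polytope P"
    by (rule chiralI[OF chiral_polytope_dual[OF chiral_polytope]])
  let ?X = "{1..poly_rank P - 1}"
  define GM where "GM = Gamma_plus (mirror_image P)"
  define GDM where "GDM = Gamma_plus (dual_polytope (mirror_image P))"
  define A where "A = \<Gamma> \<diamond> GM"
  define B where "B = D.\<Gamma> \<diamond> GDM"
  have GM: "gen_grp GM" "num_gens GM = poly_rank P - 1" "gen GM = sigma (mirror_image P)"
    and GDM: "gen_grp GDM" "num_gens GDM = poly_rank P - 1"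
      "gen GDM = sigma (dual_polytope (mirror_image P))"
    using gen_grp_Gamma_plus_mirror[OF assms(1)] by (simp_all add: GM_def GDM_def)
  have ggA: "gen_grp \<Gamma>" "gen_grp GM" "num_gens GM = num_gens \<Gamma>"
    and ggB: "gen_grp D.\<Gamma>" "gen_grp GDM" "num_gens GDM = num_gens D.\<Gamma>"
    and ggN: "gen_grp \<Gamma>" "gen_grp D.\<Gamma>" "num_gens D.\<Gamma> = num_gens \<Gamma>"
    using gen_grp_Gamma_plus D.gen_grp_Gamma_plus GM GDM by simp_all
  interpret A: generated_grp A unfolding A_def by (rule generated_grp_mix[OF ggA])
  interpret B: generated_grp B unfolding B_def by (rule generated_grp_mix[OF ggB])
  interpret N: generated_grp "\<Gamma> \<diamond> D.\<Gamma>" by (rule generated_grp_mix[OF ggN])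
  have AB: "gen_grp A" "gen_grp B" "num_gens B = num_gens A"
    by (unfold_locales) (simp_all add: A_def B_def)
  interpret H: generated_grp "A \<diamond> B" by (rule generated_grp_mix[OF AB])
  have fin: "finite (poly_auts P)" by (rule finite_poly_auts[OF assms(2)])
  have finA: "finite (carrier A)" and finB: "finite (carrier B)" and finN: "finite (carrier (\<Gamma> \<diamond> D.\<Gamma>))"
    using fin carrier_mix_subset[OF ggA] carrier_mix_subset[OF ggB] carrier_mix_subset[OF ggN]
    by (auto simp: A_def B_def GM_def GDM_def intro: finite_subset)
  have evA: "word_eval A (gen A) w = (word_eval \<Gamma> (sigma P) w, word_eval \<Gamma> (sigma (mirror_image P)) w)"
    and evB: "word_eval B (gen B) w = (word_eval \<Gamma> (sigma (dual_polytope P)) w,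
        word_eval \<Gamma> (sigma (dual_polytope (mirror_image P))) w)"
    and evN: "word_eval (\<Gamma> \<diamond> D.\<Gamma>) (gen (\<Gamma> \<diamond> D.\<Gamma>)) w =
        (word_eval \<Gamma> (sigma P) w, word_eval \<Gamma> (sigma (dual_polytope P)) w)"
    if "w \<in> words_over ?X" for w
    using word_eval_mix[OF ggA, of w] word_eval_mix[OF ggB, of w] word_eval_mix[OF ggN, of w] that
    by (simp_all add: A_def B_def GM_def GDM_def word_eval_Gamma_plus_cong[of "mirror_image P" P]
        word_eval_Gamma_plus_cong[of "dual_polytope P" P]
        word_eval_Gamma_plus_cong[of "dual_polytope (mirror_image P)" P])
  have numA: "num_gens A = poly_rank P - 1" by (simp add: A_def)
  \<comment> \<open>A word in N is trivial in all four components, so every relation of the mix of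
    \<open>P\<close> with its dual also holds in \<open>A \<diamond> B\<close>.\<close>
  have "word_eval (A \<diamond> B) (gen (A \<diamond> B)) w = \<one>\<^bsub>A \<diamond> B\<^esub>"
    if w: "w \<in> words_over ?X" and eq: "word_eval (\<Gamma> \<diamond> D.\<Gamma>) (gen (\<Gamma> \<diamond> D.\<Gamma>)) w = \<one>\<^bsub>\<Gamma> \<diamond> D.\<Gamma>\<^esub>" for w
  proof -
    have P: "word_eval \<Gamma> (sigma P) w = \<one>\<^bsub>\<Gamma>\<^esub>" "word_eval \<Gamma> (sigma (dual_polytope P)) w = \<one>\<^bsub>\<Gamma>\<^esub>"
      using evN[OF w] eq by simp_all
    note M = kernel_mirror_of_not_mix_chiral[OF not_chiral w P]
    have "word_eval (A \<diamond> B) (gen (A \<diamond> B)) w = (word_eval A (gen A) w, word_eval B (gen B) w)"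
      using word_eval_mix[OF AB] w numA by simp
    then show ?thesis
      unfolding evA[OF w] evB[OF w] P M by (simp add: A_def B_def GM_def GDM_def)
  qed
  then have "order (A \<diamond> B) \<le> order (\<Gamma> \<diamond> D.\<Gamma>)"
    using word_eval_image_card_le(2)[OF N.is_group H.is_group _ _ finN, of _ ?X] H.gen_closed N.gen_closed
      H.carrier_eq N.carrier_eq numA by (simp add: order_def)
  also have "\<dots> \<le> card (poly_auts P \<times> poly_auts P)"
    unfolding order_def using carrier_mix_subset[OF ggN] fin by (intro card_mono) auto
  finally have H: "order (A \<diamond> B) \<le> order \<Gamma> * order \<Gamma>" by (simp add: card_cartesian_product order_def)
  \<comment> \<open>Allows one factor of the product of the two orders to be replaced by the other,
    which produces the square in the hypothesis.\<close>
  have "order A \<le> order B"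
    unfolding order_def using carrier_mix_mirror_subset_dual[OF assms(1)] finB
    by (intro card_mono) (simp_all add: A_def B_def GM_def GDM_def)
  then have "order A * order A \<le> order A * order B" by simp
  also have "\<dots> \<le> order (A \<diamond> B) * order (A \<box> B)"
    by (rule order_mult_le_mix_comix[OF _ _ AB(3) finA]) unfold_locales
  also have "\<dots> \<le> order \<Gamma> * order \<Gamma> * order (A \<box> B)" using H by simp
  finally have "real (order A * order A) \<le> real (order \<Gamma> * order \<Gamma> * order (A \<box> B))"
    by (rule of_nat_mono)
  then have "(real (order A))\<^sup>2 \<le> (real (order \<Gamma>))\<^sup>2 * real (order (A \<box> B))"
    by (simp add: power2_eq_square)
  \<comment> \<open>Needed to clear the denominator; an infinite group would have
    \<open>order\<close> 0, so finiteness of the set of faces enters here.\<close>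
  moreover have "order \<Gamma> > 0"
    using fin group.is_monoid[OF group_Gamma_plus] monoid.one_closed
    by (force simp: order_def card_gt_0_iff)
  ultimately have "(real (order A) / real (order \<Gamma>))\<^sup>2 \<le> real (order (A \<box> B))"
    by (simp add: power_divide divide_le_eq mult.commute)
  then show False using assms(3) by (simp add: A_def B_def GM_def GDM_def)
qed

end
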